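(* Let $W_n$ be a random word of length $n$, either in the positive model on $\{a,b\}$ with $\Pr(a)=p\in(0,1)$, or in the standard nonbacktracking freely reduced model on $\{a,a^{-1},b,b^{-1}\}$. Then the following hold (for all $n\ge 1$). (1) There are constants $c,C,\lambda>0$, depending on the model and on $p$ in the positive case, such that \[ \Pr\bigl(\#\mathrm{supp}(f_{W_n})\ge c n^2\bigr)\ge 1-Ce^{-\lambda n}. \] (2) There are constants $c_1,c_2,C,\lambda>0$, depending on the model and on $p$ in the positive case, such that \[ \Pr\left(\exists\, i,j,k\text{ with } c_1n^3\le |[x^iy^jz^k]f_{W_n}|\le c_2n^3\right)\ge 1-Ce^{-\lambda n}. \] (3) There are constants $c_3,C_3,\lambda_3>0$, depending on the model and on $p$ in the positive case, such that \[ \Pr\bigl(\|f_{W_n}\|_{\mathrm{bit},1}\ge c_3 n^3\bigr)\ge 1-C_3e^{-\lambda_3 n}. \] (4) Fix one of these two random models. There are constants $c_4,C_4,\lambda_4>0$, depending on the model, on $p$ in the positive case, and on the precise sparse-output convention, such that for every deterministic algorithm $\mathcal A$ which computes and outputs $f_w$ in fully expanded sparse binary form on input words $w$ of length $n$ in the same model, if $T_{\mathcal A}(W_n)$ denotes the running time of $\mathcal A$ on input $W_n$, then \[ \Pr\bigl(T_{\mathcal A}(W_n)\ge c_4 n^3\bigr)\ge 1-C_4e^{-\lambda_4 n} \] for all $n\ge1$. (5) There are constants $c_5,C_5,\lambda_5>0$, depending on the precise sparse-output convention, such that for every deterministic algorithm $\mathcal A$ which computes and outputs $f_w$ in fully expanded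 sparse binary form on input cyclically reduced words $w$ of length $n$, if $U_n$ is uniformly random among cyclically reduced words of length $n$ and $T_{\mathcal A}(U_n)$ denotes the running time of $\mathcal A$ on input $U_n$, then \[ \Pr\bigl(T_{\mathcal A}(U_n)\ge c_5 n^3\bigr)\ge 1-C_5e^{-\lambda_5 n} \] for all $n\ge1$. In particular, every such algorithm has an $\Omega(n^3)$ running-time lower bound with exponentially high probability in the positive, freely reduced, and uniformly cyclically reduced models.
   Context: $F(a,b)$ is the free group on $a,b$. For $w\in F(a,b)$ and $A,B\in \mathrm{SL}(2,\mathbb C)$, $w(A,B)$ denotes the image of $w$ under $a\mapsto A$, $b\mapsto B$. The trace polynomial $f_w(x,y,z)\in\mathbb Z[x,y,z]$ is the unique polynomial such that $\mathrm{Tr}(w(A,B))=f_w(\mathrm{Tr}A,\mathrm{Tr}B,\mathrm{Tr}(AB))$ for all $A,B\in \mathrm{SL}(2,\mathbb C)$ (its existence and uniqueness are classical). Positive model: the $n$ letters are independent, each equal to $a$ with probability $p$ and to $b$ with probability $1-p$. Standard nonbacktracking freely reduced model: the first letter is uniform on $\{a,a^{-1},b,b^{-1}\}$ and each next letter is uniform among the three letters which are not the inverse of the current one. A word is cyclically reduced if it is freely reduced and its last letter is not the inverse of its first letter. $[x^iy^jz^k]f$ is the coefficient of $x^iy^jz^k$ in $f$; $\mathrm{supp}(f)$ is the set of monomials occurring with nonzero coefficient in $f$. For a nonzero integer $m$, $\mathrm{bit}(m)$ is the length of the binary expansion of $|m|$, and $\|f\|_{\mathrm{bit},1}$ is the sum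 of $\mathrm{bit}(c)$ over all nonzero coefficients $c$ of $f$. Fully expanded sparse binary form: the output is an explicit list of all monomials with nonzero coefficient in $f_w$ (with enough data to identify their exponents), each together with its coefficient written in binary. Running time is that of a deterministic Turing machine, which must write this output. *)

theory Defs
  imports "HOL-Probability.Probability" "HOL-Library.Poly_Mapping"
begin

section \<open>Words and trace polynomials\<close>

datatype letter = Pos_a | Neg_a | Pos_b | Neg_b

fun inv_letter :: "letter \<Rightarrow> letter" where
  "inv_letter Pos_a = Neg_a"
| "inv_letter Neg_a = Pos_a"
| "inv_letter Pos_b = Neg_b"
| "inv_letter Neg_b = Pos_b"

text \<open>An element of the free group \<open>F(a,b)\<close> is represented by a word in the letters
  \<open>a\<close>, \<open>a\<^sup>-\<^sup>1\<close>, \<open>b\<close>, \<open>b\<^sup>-\<^sup>1\<close>; all words occurring below are freely reduced.\<close>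

type_synonym word = "letter list"

definition freely_reduced :: "word \<Rightarrow> bool" where
  "freely_reduced w \<longleftrightarrow> successively (\<lambda>s t. t \<noteq> inv_letter s) w"

definition cyclically_reduced :: "word \<Rightarrow> bool" where
  "cyclically_reduced w \<longleftrightarrow> freely_reduced w \<and> (w \<noteq> [] \<longrightarrow> last w \<noteq> inv_letter (hd w))"

fun letter_image :: "complex^2^2 \<Rightarrow> complex^2^2 \<Rightarrow> letter \<Rightarrow> complex^2^2" where
  "letter_image A B Pos_a = A"
| "letter_image A B Neg_a = matrix_inv A"
| "letter_image A B Pos_b = B"
| "letter_image A B Neg_b = matrix_inv B"

definition word_image :: "complex^2^2 \<Rightarrow> complex^2^2 \<Rightarrow> word \<Rightarrow> complex^2^2" where
  "word_image A B w = foldr (\<lambda>s M. letter_image A B s ** M) w (mat 1)"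

text \<open>Elements of \<open>\<int>[x,y,z]\<close>: the key \<open>(i,j,k)\<close> stands for the monomial
  \<open>x\<^sup>iy\<^sup>jz\<^sup>k\<close>, \<^const>\<open>Poly_Mapping.lookup\<close> gives the coefficients
  and \<^const>\<open>Poly_Mapping.keys\<close> the support.\<close>

type_synonym poly3 = "(nat \<times> nat \<times> nat) \<Rightarrow>\<^sub>0 int"

definition poly3_eval :: "poly3 \<Rightarrow> complex \<Rightarrow> complex \<Rightarrow> complex \<Rightarrow> complex" where
  "poly3_eval f x y z =
    (\<Sum>(i, j, k)\<in>Poly_Mapping.keys f.
       of_int (Poly_Mapping.lookup f (i, j, k)) * x ^ i * y ^ j * z ^ k)"

definition trace_poly :: "word \<Rightarrow> poly3" where
  "trace_poly w = (THE f. \<forall>A B :: complex^2^2. det A = 1 \<longrightarrow> det B = 1 \<longrightarrow>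
     trace (word_image A B w) = poly3_eval f (trace A) (trace B) (trace (A ** B)))"

text \<open>Binary expansion, most significant digit first, without leading zeros.\<close>

fun binary_expansion :: "nat \<Rightarrow> bool list" where
  "binary_expansion m = (if m = 0 then [] else binary_expansion (m div 2) @ [odd m])"

declare binary_expansion.simps [simp del]

definition bit_length :: "int \<Rightarrow> nat" where
  "bit_length m = length (binary_expansion (nat \<bar>m\<bar>))"

definition bit_norm :: "poly3 \<Rightarrow> nat" where
  "bit_norm f = (\<Sum>m\<in>Poly_Mapping.keys f. bit_length (Poly_Mapping.lookup f m))"

section \<open>Random words\<close>

definition positive_word :: "real \<Rightarrow> nat \<Rightarrow> word pmf" where
  "positive_word p n =
     replicate_pmf n (map_pmf (\<lambda>h. if h then Pos_a else Pos_b) (bernoulli_pmf p))"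

text \<open>The next \<open>n\<close> letters of a nonbacktracking word whose current letter is \<open>s\<close>.\<close>

primrec reduced_continuation :: "nat \<Rightarrow> letter \<Rightarrow> word pmf" where
  "reduced_continuation 0 s = return_pmf []"
| "reduced_continuation (Suc n) s =
     bind_pmf (pmf_of_set (UNIV - {inv_letter s}))
       (\<lambda>t. map_pmf (\<lambda>v. t # v) (reduced_continuation n t))"

primrec reduced_word :: "nat \<Rightarrow> word pmf" where
  "reduced_word 0 = return_pmf []"
| "reduced_word (Suc n) =
     bind_pmf (pmf_of_set UNIV) (\<lambda>s. map_pmf (\<lambda>v. s # v) (reduced_continuation n s))"

definition word_models :: "(nat \<Rightarrow> word pmf) set" where
  "word_models = {positive_word p | p. 0 < p \<and> p < 1} \<union> {reduced_word}"

definition cyc_reduced_word :: "nat \<Rightarrow> word pmf" where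
  "cyc_reduced_word n = pmf_of_set {w. length w = n \<and> cyclically_reduced w}"

section \<open>Deterministic Turing machines\<close>

text \<open>Multitape machines (one or more tapes) with one-way infinite tapes. Tape symbols and
  states are initial segments of the natural numbers; symbol \<open>0\<close> is the blank, symbols \<open>1\<close>
  and \<open>2\<close> are the binary digits, symbols \<open>3\<close> to \<open>6\<close> are the letters of the input alphabet.\<close>

datatype move = Move_left | Move_stay | Move_right

record tm =
  num_tapes :: nat
  num_symbols :: nat
  num_states :: nat
  start_state :: nat
  halt_state :: nat
  delta :: "nat \<Rightarrow> nat list \<Rightarrow> nat \<times> (nat \<times> move) list"

definition wf_tm :: "tm \<Rightarrow> bool" where
  "wf_tm M \<longleftrightarrow> num_tapes M \<ge> 1 \<and> num_symbols M \<ge> 7 \<and>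
     start_state M < num_states M \<and> halt_state M < num_states M \<and>
     (\<forall>q < num_states M. \<forall>ss. q \<noteq> halt_state M \<and> length ss = num_tapes M \<and>
        set ss \<subseteq> {..<num_symbols M} \<longrightarrow>
        fst (delta M q ss) < num_states M \<and>
        length (snd (delta M q ss)) = num_tapes M \<and>
        fst ` set (snd (delta M q ss)) \<subseteq> {..<num_symbols M})"

text \<open>A configuration consists of the state and, for every tape, its contents and its head
  position. Moving left from cell \<open>0\<close> leaves the head where it is.\<close>

type_synonym config = "nat \<times> ((nat \<Rightarrow> nat) \<times> nat) list"

fun move_head :: "move \<Rightarrow> nat \<Rightarrow> nat" where
  "move_head Move_left h = h - 1"
| "move_head Move_stay h = h"
| "move_head Move_right h = h + 1"

definition tm_step :: "tm \<Rightarrow> config \<Rightarrow> config" where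
  "tm_step M = (\<lambda>(q, tps).
     if q = halt_state M then (q, tps)
     else let (q', acts) = delta M q (map (\<lambda>(t, h). t h) tps)
          in (q', map2 (\<lambda>(s, d) (t, h). (t(h := s), move_head d h)) acts tps))"

fun letter_symbol :: "letter \<Rightarrow> nat" where
  "letter_symbol Pos_a = 3"
| "letter_symbol Neg_a = 4"
| "letter_symbol Pos_b = 5"
| "letter_symbol Neg_b = 6"

definition input_tape :: "word \<Rightarrow> nat \<Rightarrow> nat" where
  "input_tape w i = (if i < length w then letter_symbol (w ! i) else 0)"

text \<open>The input is on the first tape and the output is read off the last tape, from cell \<open>0\<close> up
  to the first blank; on a single-tape machine these are the same tape.\<close>

definition tm_init :: "tm \<Rightarrow> word \<Rightarrow> config" where
  "tm_init M w =
     (start_state M, (input_tape w, 0) # replicate (num_tapes M - 1) (\<lambda>_. 0, 0))"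

definition tm_run :: "tm \<Rightarrow> word \<Rightarrow> nat \<Rightarrow> config" where
  "tm_run M w t = (tm_step M ^^ t) (tm_init M w)"

definition tm_halts :: "tm \<Rightarrow> word \<Rightarrow> bool" where
  "tm_halts M w \<longleftrightarrow> (\<exists>t. fst (tm_run M w t) = halt_state M)"

definition running_time :: "tm \<Rightarrow> word \<Rightarrow> nat" where
  "running_time M w = (LEAST t. fst (tm_run M w t) = halt_state M)"

definition tm_outputs :: "tm \<Rightarrow> word \<Rightarrow> nat list \<Rightarrow> bool" where
  "tm_outputs M w out \<longleftrightarrow> tm_halts M w \<and>
     (let tape = fst (last (snd (tm_run M w (running_time M w))))
      in (\<forall>i < length out. tape i = out ! i) \<and> tape (length out) = 0)"

section \<open>Fully expanded sparse binary form\<close>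

definition binary_string :: "nat \<Rightarrow> nat list" where
  "binary_string m = map (\<lambda>d. if d then 2 else 1) (binary_expansion m)"

text \<open>\<open>R f out\<close> means that the string \<open>out\<close> is an admissible output for \<open>f\<close>. Every monomial
  of the support is listed exactly once, in an order the convention is free to choose or to leave
  open, with the absolute value of its coefficient in binary. The strings around it carry the
  sign, the exponents and the separators; how they do so is up to the convention, but the output
  has to determine \<open>f\<close>. The output alphabet is finite and does not contain the blank.\<close>

definition sparse_binary_convention :: "(poly3 \<Rightarrow> nat list \<Rightarrow> bool) \<Rightarrow> bool" where
  "sparse_binary_convention R \<longleftrightarrow>
     (\<exists>G. \<forall>f out. R f out \<longrightarrow> set out \<subseteq> {1..<G}) \<and>
     (\<forall>f. \<exists>out. R f out) \<and>
     (\<forall>f g out. R f out \<and> R g out \<longrightarrow> f = g) \<and>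
     (\<forall>f out. R f out \<longrightarrow>
        (\<exists>ms before after header trailer.
           distinct ms \<and> set ms = Poly_Mapping.keys f \<and>
           out = header @
             concat (map (\<lambda>m. before m @ binary_string (nat \<bar>Poly_Mapping.lookup f m\<bar>) @ after m) ms)
             @ trailer))"

definition computes_trace_poly_on ::
  "tm \<Rightarrow> (poly3 \<Rightarrow> nat list \<Rightarrow> bool) \<Rightarrow> word set \<Rightarrow> bool" where
  "computes_trace_poly_on M R S \<longleftrightarrow>
     wf_tm M \<and> (\<forall>w\<in>S. \<exists>out. R (trace_poly w) out \<and> tm_outputs M w out)"

end

theory Submission
  imports Defs "HOL-Computational_Algebra.Polynomial"
begin

text \<open>
  Everything is read off the top coefficient of \<open>f\<^sub>w\<close> in \<open>z\<close>. If \<open>w\<close> is conjugate to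
  \<open>a\<^bsup>p\<^sub>1\<^esup> b\<^bsup>q\<^sub>1\<^esup> \<dots> a\<^bsup>p\<^sub>m\<^esup> b\<^bsup>q\<^sub>m\<^esup>\<close> with nonzero exponents, then the coefficient of \<open>z\<^sup>m\<close> is, up to sign,
  \<open>\<Prod> U\<^bsub>|p\<^sub>i|\<^esub>(x) \<cdot> \<Prod> U\<^bsub>|q\<^sub>i|\<^esub>(y)\<close> for the Chebyshev-type polynomials
  \<open>U\<^sub>0 = 0\<close>, \<open>U\<^sub>1 = 1\<close>, \<open>U\<^bsub>k+2\<^esub> = x U\<^bsub>k+1\<^esub> - U\<^sub>k\<close>. Substituting \<open>\<i>x\<close> for \<open>x\<close> removes all signs, so
  nothing cancels in such a product: every factor \<open>U\<^sub>3 = x\<^sup>2 - 1\<close> contributes like \<open>1 + x\<^sup>2\<close>, and if there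
  are \<open>c\<close> of them in both variables, then the coefficient of \<open>z\<^sup>m\<close> has at least \<open>(c + 1)\<^sup>2\<close> monomials,
  with coefficients at least products of binomial coefficients \<open>c choose i\<close>; the coefficient
  with index \<open>c - 3\<close> in \<open>x\<close> and leading in \<open>y\<close> is of order \<open>n\<^sup>3\<close>. With exponentially
  high probability a random word contains linearly many disjoint copies of \<open>b a\<^sup>3 b\<^sup>3 a\<close> and loses only a
  small proportion of its letters under cyclic reduction, so that \<open>c\<close> is linear in \<open>n\<close>. A Turing machine writes at
  most one cell per tape and step, hence its running time is at least the output length minus \<open>n\<close>.
\<close>

section \<open>Polynomials in three variables\<close>

definition mono3 :: "nat \<times> nat \<times> nat \<Rightarrow> complex \<Rightarrow> complex \<Rightarrow> complex \<Rightarrow> complex" where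
  "mono3 m x y z = (case m of (i, j, k) \<Rightarrow> x ^ i * y ^ j * z ^ k)"

lemma mono3_add:
  "mono3 (fst m + fst m', fst (snd m) + fst (snd m'), snd (snd m) + snd (snd m')) x y z
   = mono3 m x y z * mono3 m' x y z"
  by (cases m; cases m') (simp add: mono3_def power_add)

lemma poly3_eval_mono3:
  "poly3_eval f x y z = (\<Sum>m\<in>Poly_Mapping.keys f. of_int (Poly_Mapping.lookup f m) * mono3 m x y z)"
  unfolding poly3_eval_def mono3_def by (intro sum.cong) (auto simp: mult_ac)

lemma poly3_eval_superset:
  assumes "finite S" "Poly_Mapping.keys f \<subseteq> S"
  shows "poly3_eval f x y z = (\<Sum>m\<in>S. of_int (Poly_Mapping.lookup f m) * mono3 m x y z)"
  unfolding poly3_eval_mono3 using assms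
  by (intro sum.mono_neutral_left) (auto simp: in_keys_iff)

lemma poly3_eval_0 [simp]: "poly3_eval 0 x y z = 0"
  by (simp add: poly3_eval_def)

lemma poly3_eval_single [simp]:
  "poly3_eval (Poly_Mapping.single m c) x y z = of_int c * mono3 m x y z"
  by (subst poly3_eval_superset[where S = "{m}"]) auto

lemma poly3_eval_add [simp]: "poly3_eval (f + g) x y z = poly3_eval f x y z + poly3_eval g x y z"
proof -
  let ?S = "Poly_Mapping.keys f \<union> Poly_Mapping.keys g"
  have "Poly_Mapping.keys (f + g) \<subseteq> ?S" by (rule Poly_Mapping.keys_add)
  then show ?thesis
    by (simp add: poly3_eval_superset[where S = ?S] lookup_add sum.distrib algebra_simps)
qed

lemma poly3_eval_diff [simp]: "poly3_eval (f - g) x y z = poly3_eval f x y z - poly3_eval g x y z"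
  using poly3_eval_add[of "f - g" g x y z] by simp

lemma poly3_eval_sum: "poly3_eval (sum h S) x y z = (\<Sum>s\<in>S. poly3_eval (h s) x y z)"
  by (induction S rule: infinite_finite_induct) auto

text \<open>Polynomiality with integer coefficients is tracked for functions of three complex
  variables, so that the recursion over words only needs closure under sums, differences and
  products.\<close>

definition poly3_fun :: "(complex \<Rightarrow> complex \<Rightarrow> complex \<Rightarrow> complex) \<Rightarrow> bool" where
  "poly3_fun F \<longleftrightarrow> (\<exists>f. \<forall>x y z. F x y z = poly3_eval f x y z)"

lemma poly3_fun_monom: "poly3_fun (\<lambda>x y z. of_int c * mono3 m x y z)"
  unfolding poly3_fun_def by (rule exI[of _ "Poly_Mapping.single m c"]) simp

lemma poly3_fun_basic [intro]:
  "poly3_fun (\<lambda>x y z. of_int c)" "poly3_fun (\<lambda>x y z. x)" "poly3_fun (\<lambda>x y z. y)" "poly3_fun (\<lambda>x y z. z)"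
  using poly3_fun_monom[of c "(0,0,0)"] poly3_fun_monom[of 1 "(1,0,0)"]
    poly3_fun_monom[of 1 "(0,1,0)"] poly3_fun_monom[of 1 "(0,0,1)"]
  by (simp_all add: mono3_def)

lemma poly3_fun_add [intro]:
  "poly3_fun F \<Longrightarrow> poly3_fun G \<Longrightarrow> poly3_fun (\<lambda>x y z. F x y z + G x y z)"
  unfolding poly3_fun_def by (metis poly3_eval_add)

lemma poly3_fun_diff [intro]:
  "poly3_fun F \<Longrightarrow> poly3_fun G \<Longrightarrow> poly3_fun (\<lambda>x y z. F x y z - G x y z)"
  unfolding poly3_fun_def by (metis poly3_eval_diff)

lemma poly3_fun_mult [intro]:
  assumes "poly3_fun F" "poly3_fun G"
  shows "poly3_fun (\<lambda>x y z. F x y z * G x y z)"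
proof -
  obtain f g where f: "\<And>x y z. F x y z = poly3_eval f x y z" and g: "\<And>x y z. G x y z = poly3_eval g x y z"
    using assms unfolding poly3_fun_def by blast
  let ?h = "\<Sum>m\<in>Poly_Mapping.keys f. \<Sum>m'\<in>Poly_Mapping.keys g.
    Poly_Mapping.single (fst m + fst m', fst (snd m) + fst (snd m'), snd (snd m) + snd (snd m'))
      (Poly_Mapping.lookup f m * Poly_Mapping.lookup g m')"
  have "F x y z * G x y z = poly3_eval ?h x y z" for x y z
    unfolding poly3_eval_sum poly3_eval_single mono3_add f g poly3_eval_mono3[of f] poly3_eval_mono3[of g]
      sum_product by (intro sum.cong) auto
  then show ?thesis unfolding poly3_fun_def by blast
qed

section \<open>Reading a coefficient off as a limit in z\<close>

definition z_slice :: "poly3 \<Rightarrow> nat \<Rightarrow> complex \<Rightarrow> complex \<Rightarrow> complex poly" where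
  "z_slice f N x y = (\<Sum>k\<le>N. monom (\<Sum>j\<le>N. (\<Sum>i\<le>N. of_int (Poly_Mapping.lookup f (i,j,k)) * x ^ i) * y ^ j) k)"

lemma poly3_exponent_bound: "\<exists>N. \<forall>i j k. (i,j,k) \<in> Poly_Mapping.keys (f :: poly3) \<longrightarrow> i \<le> N \<and> j \<le> N \<and> k \<le> N"
proof -
  have "finite ((\<lambda>(i,j,k). i + j + k) ` Poly_Mapping.keys f)" by simp
  then obtain N where "\<forall>s\<in>(\<lambda>(i,j,k). i + j + k) ` Poly_Mapping.keys f. s \<le> N"
    using finite_nat_set_iff_bounded_le by blast
  then show ?thesis by (intro exI[of _ N]) force
qed

lemma poly3_eval_z_slice:
  assumes "\<And>i j k. (i,j,k) \<in> Poly_Mapping.keys f \<Longrightarrow> i \<le> N \<and> j \<le> N \<and> k \<le> N"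
  shows "poly3_eval f x y z = poly (z_slice f N x y) z"
proof -
  have "poly3_eval f x y z = (\<Sum>m\<in>{..N} \<times> {..N} \<times> {..N}. of_int (Poly_Mapping.lookup f m) * mono3 m x y z)"
    using assms by (intro poly3_eval_superset) auto
  also have "\<dots> = (\<Sum>i\<le>N. \<Sum>j\<le>N. \<Sum>k\<le>N. of_int (Poly_Mapping.lookup f (i,j,k)) * mono3 (i,j,k) x y z)"
    by (simp add: sum.cartesian_product)
  also have "\<dots> = (\<Sum>i\<le>N. \<Sum>k\<le>N. \<Sum>j\<le>N. of_int (Poly_Mapping.lookup f (i,j,k)) * mono3 (i,j,k) x y z)"
    by (intro sum.cong refl sum.swap)
  also have "\<dots> = (\<Sum>k\<le>N. \<Sum>i\<le>N. \<Sum>j\<le>N. of_int (Poly_Mapping.lookup f (i,j,k)) * mono3 (i,j,k) x y z)"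
    by (rule sum.swap)
  also have "\<dots> = (\<Sum>k\<le>N. \<Sum>j\<le>N. \<Sum>i\<le>N. of_int (Poly_Mapping.lookup f (i,j,k)) * mono3 (i,j,k) x y z)"
    by (intro sum.cong refl sum.swap)
  also have "\<dots> = poly (z_slice f N x y) z"
    by (simp add: z_slice_def poly_sum poly_monom mono3_def sum_distrib_right sum_distrib_left mult_ac)
  finally show ?thesis .
qed

text \<open>After division by \<open>g t ^ N\<close> the term of degree i carries
  \<open>(1 / g t) ^ (N - i)\<close>, which vanishes in the limit unless i = N.\<close>

lemma tendsto_poly_over_power:
  fixes p :: "complex poly"
  assumes "degree p \<le> N" "filterlim g at_infinity F"
  shows "((\<lambda>t. poly p (g t) / g t ^ N) \<longlongrightarrow> coeff p N) F"
proof -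
  have nz: "eventually (\<lambda>t. g t \<noteq> 0) F"
    using assms(2) filterlim_at_infinity_imp_eventually_ne by blast
  have lim: "((\<lambda>t. coeff p i * (inverse (g t)) ^ (N - i)) \<longlongrightarrow> coeff p i * 0 ^ (N - i)) F" for i
    by (intro tendsto_intros filterlim_compose[OF tendsto_inverse_0 assms(2)])
  have "((\<lambda>t. \<Sum>i\<le>N. coeff p i * (inverse (g t)) ^ (N - i)) \<longlongrightarrow> (\<Sum>i\<le>N. coeff p i * 0 ^ (N - i))) F"
    by (intro tendsto_sum lim)
  also have "(\<Sum>i\<le>N. coeff p i * 0 ^ (N - i)) = (\<Sum>i\<in>{N}. coeff p i * 0 ^ (N - i))"
    by (intro sum.mono_neutral_right) (auto simp: power_0_left)
  finally have L: "((\<lambda>t. \<Sum>i\<le>N. coeff p i * (inverse (g t)) ^ (N - i)) \<longlongrightarrow> coeff p N) F" by simp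
  have "eventually (\<lambda>t. (\<Sum>i\<le>N. coeff p i * (inverse (g t)) ^ (N - i)) = poly p (g t) / g t ^ N) F"
    using nz
  proof eventually_elim
    case (elim t)
    have "poly p (g t) = (\<Sum>i\<le>N. coeff p i * g t ^ i)"
      unfolding poly_altdef using assms(1) by (intro sum.mono_neutral_left) (auto simp: coeff_eq_0)
    moreover have "g t ^ i / g t ^ N = inverse (g t) ^ (N - i)" if "i \<le> N" for i
      using that elim by (simp add: power_diff field_simps power_inverse)
    ultimately show ?case
      by (simp add: sum_divide_distrib flip: times_divide_eq_right)
  qed
  with L show ?thesis by (rule Lim_transform_eventually)
qed

text \<open>No degree bound is assumed: if the degree exceeded m, multiplying the finite limit by a
  positive power of \<open>1 / g t\<close> would force the leading coefficient to be 0.\<close>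

lemma coeff_eq_limit:
  fixes p :: "complex poly"
  assumes g: "filterlim g at_infinity F" and F: "F \<noteq> bot"
    and lim: "((\<lambda>t. poly p (g t) / g t ^ m) \<longlongrightarrow> L) F"
  shows "coeff p m = L"
proof (cases "degree p \<le> m")
  case True
  from tendsto_unique[OF F tendsto_poly_over_power[OF this g] lim] show ?thesis .
next
  case False
  let ?N = "degree p"
  have nz: "eventually (\<lambda>t. g t \<noteq> 0) F"
    using g filterlim_at_infinity_imp_eventually_ne by blast
  have "((\<lambda>t. (poly p (g t) / g t ^ m) * inverse (g t) ^ (?N - m)) \<longlongrightarrow> L * 0 ^ (?N - m)) F"
    by (intro tendsto_intros lim filterlim_compose[OF tendsto_inverse_0 g])
  moreover have "eventually (\<lambda>t. (poly p (g t) / g t ^ m) * inverse (g t) ^ (?N - m) = poly p (g t) / g t ^ ?N) F"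
    using nz by eventually_elim (use False in \<open>simp add: power_diff field_simps power_inverse\<close>)
  ultimately have "((\<lambda>t. poly p (g t) / g t ^ ?N) \<longlongrightarrow> L * 0 ^ (?N - m)) F"
    by (rule Lim_transform_eventually)
  from tendsto_unique[OF F this tendsto_poly_over_power[OF order.refl g]] False
  have "coeff p ?N = 0" by (simp add: power_0_left)
  with False show ?thesis by simp
qed

lemma poly_eq_complexI: "(\<And>x::complex. poly p x = poly q x) \<Longrightarrow> p = q"
  by (metis poly_eq_poly_eq_iff ext)

text \<open>For fixed x and y, \<open>coeff_eq_limit\<close> identifies the coefficient of z^m. That
  coefficient is a polynomial in y whose coefficients are polynomials in x, so comparing polynomial
  functions first in y and then in x separates the exponents. The limit runs along z =
  \<open>g t\<close> because later t is a matrix parameter with z = t + 1/t.\<close>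

lemma lookup_eq_limit:
  fixes P Q :: "complex poly"
  assumes g: "filterlim g at_infinity F" and F: "F \<noteq> bot"
    and lim: "\<And>x y. ((\<lambda>t. poly3_eval f x y (g t) / g t ^ m) \<longlongrightarrow> poly P x * poly Q y) F"
  shows "of_int (Poly_Mapping.lookup f (i, j, m)) = coeff P i * coeff Q j"
proof -
  obtain N0 where N0: "\<And>i j k. (i,j,k) \<in> Poly_Mapping.keys f \<Longrightarrow> i \<le> N0 \<and> j \<le> N0 \<and> k \<le> N0"
    using poly3_exponent_bound by blast
  \<comment> \<open>N also dominates i, j and m, so that the sums up to N contain the requested
    coefficient even where it is 0.\<close>
  define N where "N = Max {N0, i, j, m}"
  have le: "i \<le> N" "j \<le> N" "m \<le> N" "N0 \<le> N" by (auto simp: N_def)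
  have N: "\<And>i j k. (i,j,k) \<in> Poly_Mapping.keys f \<Longrightarrow> i \<le> N \<and> j \<le> N \<and> k \<le> N"
    using N0 le by (meson order.trans)
  define c where "c = (\<lambda>i j. of_int (Poly_Mapping.lookup f (i,j,m)) :: complex)"
  define q where "q = (\<lambda>x. \<Sum>j\<le>N. monom (\<Sum>i\<le>N. c i j * x ^ i) j)"
  have "coeff (z_slice f N x y) m = poly P x * poly Q y" for x y
    using coeff_eq_limit[OF g F] lim[of x y] by (simp add: poly3_eval_z_slice[OF N])
  moreover have "coeff (z_slice f N x y) m = poly (q x) y" for x y
    using le by (simp add: z_slice_def coeff_sum coeff_monom q_def c_def poly_sum poly_monom sum.delta)
  ultimately have "q x = smult (poly P x) Q" for x
    by (intro poly_eq_complexI) simp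
  then have "coeff (q x) j = poly P x * coeff Q j" for x by simp
  moreover have "coeff (q x) j = poly (\<Sum>i\<le>N. monom (c i j) i) x" for x
    using le by (simp add: q_def coeff_sum coeff_monom poly_sum poly_monom sum.delta)
  ultimately have "(\<Sum>i\<le>N. monom (c i j) i) = smult (coeff Q j) P"
    by (intro poly_eq_complexI) (simp add: mult.commute)
  then have "coeff (\<Sum>i\<le>N. monom (c i j) i) i = coeff P i * coeff Q j" by (simp add: mult.commute)
  then show ?thesis using le by (simp add: coeff_sum coeff_monom sum.delta c_def)
qed

text \<open>The difference vanishes identically, so \<open>lookup_eq_limit\<close> applies to it
  with P = Q = 0.\<close>

lemma poly3_eval_inject:
  assumes "\<And>x y z. poly3_eval f x y z = poly3_eval g x y z"
  shows "f = g"
proof -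
  have "Poly_Mapping.lookup (f - g) (i, j, k) = 0" for i j k
  proof -
    have "of_int (Poly_Mapping.lookup (f - g) (i, j, k)) = coeff (0::complex poly) i * coeff 0 j"
      by (rule lookup_eq_limit[where g = "\<lambda>t::complex. t" and F = at_infinity])
         (simp_all add: assms filterlim_ident trivial_limit_at_infinity)
    then show ?thesis by simp
  qed
  then have "Poly_Mapping.lookup f m = Poly_Mapping.lookup g m" for m
    by (cases m) (simp add: lookup_minus)
  then show ?thesis by (rule poly_mapping_eqI)
qed

section \<open>Words in two generic matrices\<close>

definition mat2 :: "'a \<Rightarrow> 'a \<Rightarrow> 'a \<Rightarrow> 'a \<Rightarrow> 'a^2^2" where
  "mat2 a b c d = (\<chi> i j. if i = 1 then (if j = 1 then a else b) else (if j = 1 then c else d))"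

lemma mat2_nth [simp]:
  "mat2 a b c d $ 1 $ 1 = a" "mat2 a b c d $ 1 $ 2 = b" "mat2 a b c d $ 2 $ 1 = c" "mat2 a b c d $ 2 $ 2 = d"
  by (simp_all add: mat2_def)

lemma mat2_eqI:
  fixes M N :: "'a^2^2"
  assumes "M $ 1 $ 1 = N $ 1 $ 1" "M $ 1 $ 2 = N $ 1 $ 2" "M $ 2 $ 1 = N $ 2 $ 1" "M $ 2 $ 2 = N $ 2 $ 2"
  shows "M = N"
  using assms by (simp add: vec_eq_iff forall_2)

lemma matrix_mult_nth_2: "((M::'a::semiring_1^2^2) ** N) $ i $ j = M $ i $ 1 * N $ 1 $ j + M $ i $ 2 * N $ 2 $ j"
  by (simp add: matrix_matrix_mult_def sum_2)

lemma mat_1_nth_2 [simp]: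
  "(mat 1 :: 'a::{one,zero}^2^2) $ 1 $ 1 = 1" "(mat 1 :: 'a^2^2) $ 1 $ 2 = 0"
  "(mat 1 :: 'a^2^2) $ 2 $ 1 = 0" "(mat 1 :: 'a^2^2) $ 2 $ 2 = 1"
  by (simp_all add: mat_def)

lemma trace_2: "trace (M::'a::comm_semiring_1^2^2) = M $ 1 $ 1 + M $ 2 $ 2"
  by (simp add: trace_def sum_2)

lemma matrix_inv_eqI:
  fixes M N :: "'a::semiring_1^'n^'n"
  assumes "M ** N = mat 1" "N ** M = mat 1"
  shows "matrix_inv M = N"
proof -
  have "M ** matrix_inv M = mat 1 \<and> matrix_inv M ** M = mat 1"
    unfolding matrix_inv_def by (rule someI_ex) (use assms in blast)
  then show ?thesis
    by (metis assms(2) matrix_mul_assoc matrix_mul_lid matrix_mul_rid)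
qed

lemma matrix_inv_2:
  fixes M :: "complex^2^2"
  assumes "det M = 1"
  shows "matrix_inv M = mat2 (M$2$2) (- M$1$2) (- M$2$1) (M$1$1)"
  using assms by (intro matrix_inv_eqI mat2_eqI) (simp_all add: matrix_mult_nth_2 det_2 algebra_simps)

text \<open>This is Cayley-Hamilton for determinant 1; it reduces every inverse letter to the letter
  itself.\<close>

lemma matrix_inv_nth_2:
  fixes M :: "complex^2^2"
  assumes "det M = 1"
  shows "matrix_inv M $ i $ j = trace M * mat 1 $ i $ j - M $ i $ j"
  using exhaust_2[of i] exhaust_2[of j] by (auto simp: matrix_inv_2[OF assms] trace_2)

lemma det_matrix_inv_2: "det (M :: complex^2^2) = 1 \<Longrightarrow> det (matrix_inv M) = 1"
  by (simp add: matrix_inv_2 det_2 mult.commute)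

lemma trace_matrix_inv_2: "det (M :: complex^2^2) = 1 \<Longrightarrow> trace (matrix_inv M) = trace M"
  by (simp add: matrix_inv_2 trace_2)

lemma letter_image_inv_letter:
  assumes "det A = 1" "det B = 1"
  shows "letter_image A B s ** letter_image A B (inv_letter s) = mat 1"
  by (cases s; rule mat2_eqI)
     (use assms in \<open>simp_all add: matrix_inv_2 matrix_mult_nth_2 det_2 algebra_simps\<close>)

lemma word_image_Nil [simp]: "word_image A B [] = mat 1"
  and word_image_Cons [simp]: "word_image A B (s # w) = letter_image A B s ** word_image A B w"
  by (simp_all add: word_image_def)

lemma word_image_append: "word_image A B (u @ v) = word_image A B u ** word_image A B v"
  by (induction u) (simp_all add: matrix_mul_assoc)

definition inv_word :: "word \<Rightarrow> word" where
  "inv_word u = rev (map inv_letter u)"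

lemma word_image_inv_word:
  assumes "det A = 1" "det B = 1"
  shows "word_image A B u ** word_image A B (inv_word u) = mat 1"
proof (induction u)
  case (Cons s u)
  have "word_image A B (s # u) ** word_image A B (inv_word (s # u))
    = letter_image A B s ** ((word_image A B u ** word_image A B (inv_word u)) ** letter_image A B (inv_letter s))"
    by (simp add: inv_word_def word_image_append matrix_mul_assoc)
  then show ?case
    using Cons letter_image_inv_letter[OF assms] by simp
qed (simp add: inv_word_def)

lemma trace_word_image_rotate: "trace (word_image A B (u @ v)) = trace (word_image A B (v @ u))"
  unfolding word_image_append by (rule trace_mul_sym)

lemma trace_word_image_conj:
  assumes "det A = 1" "det B = 1"
  shows "trace (word_image A B (u @ v @ inv_word u)) = trace (word_image A B v)"
proof -
  have "inv_word (inv_word u) = u"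
  proof -
    have "inv_letter (inv_letter s) = s" for s by (cases s) auto
    then have "inv_letter \<circ> inv_letter = id" by (simp add: fun_eq_iff)
    then show ?thesis by (simp add: inv_word_def rev_map)
  qed
  then have "word_image A B (inv_word u) ** word_image A B u = mat 1"
    using word_image_inv_word[OF assms, of "inv_word u"] by simp
  then have "word_image A B (v @ inv_word u @ u) = word_image A B v"
    by (simp add: word_image_append)
  then show ?thesis
    using trace_word_image_rotate[of A B u "v @ inv_word u"] by simp
qed

section \<open>Cayley-Hamilton identities and the normal form of word matrices\<close>

lemma square_nth_2:
  fixes M :: "complex^2^2"
  assumes "det M = 1"
  shows "(M ** M) $ i $ j = trace M * M $ i $ j - mat 1 $ i $ j"
  using assms exhaust_2[of i] exhaust_2[of j]
  by (auto simp: matrix_mult_nth_2 trace_2 det_2 algebra_simps)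

text \<open>The polarised form of Cayley-Hamilton, which compares the squares of A + B, A and
  B.\<close>

lemma swap_nth_2:
  fixes A B :: "complex^2^2"
  shows "(B ** A) $ i $ j = trace B * A $ i $ j + trace A * B $ i $ j
    + (trace (A ** B) - trace A * trace B) * mat 1 $ i $ j - (A ** B) $ i $ j"
  using exhaust_2[of i] exhaust_2[of j]
  by (auto simp: matrix_mult_nth_2 trace_2 algebra_simps)

lemma mult_square_nth_2:
  fixes A B :: "complex^2^2"
  assumes "det A = 1"
  shows "(A ** (A ** B)) $ i $ j = trace A * (A ** B) $ i $ j - B $ i $ j"
  unfolding matrix_mul_assoc matrix_mult_nth_2[of "A ** A"] square_nth_2[OF assms]
  using exhaust_2[of i] exhaust_2[of j]
  by (auto simp: matrix_mult_nth_2 algebra_simps)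

lemma mult_square_right_nth_2:
  fixes A B :: "complex^2^2"
  assumes "det B = 1"
  shows "(A ** (B ** B)) $ i $ j = trace B * (A ** B) $ i $ j - A $ i $ j"
  unfolding matrix_mult_nth_2[of A] square_nth_2[OF assms]
  using exhaust_2[of i] exhaust_2[of j]
  by (auto simp: matrix_mult_nth_2 algebra_simps)

text \<open>Expand BA by \<open>swap_nth_2\<close> and multiply by B on the right; the squares of B
  that arise are reduced by Cayley-Hamilton.\<close>

lemma sandwich_nth_2:
  fixes A B :: "complex^2^2"
  assumes "det B = 1"
  shows "(B ** (A ** B)) $ i $ j = A $ i $ j - trace A * mat 1 $ i $ j + trace (A ** B) * B $ i $ j"
proof -
  have "(B ** (A ** B)) $ i $ j = (B ** A) $ i $ 1 * B $ 1 $ j + (B ** A) $ i $ 2 * B $ 2 $ j"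
    by (simp only: matrix_mul_assoc matrix_mult_nth_2)
  also have "\<dots> = trace B * (A ** B) $ i $ j + trace A * (B ** B) $ i $ j
      + (trace (A ** B) - trace A * trace B) * (mat 1 ** B) $ i $ j - ((A ** B) ** B) $ i $ j"
    unfolding swap_nth_2[of B A] matrix_mult_nth_2[of "A ** B"] matrix_mult_nth_2[of A B i j]
      matrix_mult_nth_2[of B B i j] matrix_mult_nth_2[of "mat 1"]
    by (simp add: algebra_simps)
  finally show ?thesis
    by (simp add: matrix_mul_assoc[symmetric] mult_square_right_nth_2[OF assms] square_nth_2[OF assms] algebra_simps)
qed

text \<open>The span of I, A, B, AB over Z[x,y,z] is stable under left multiplication by A and B,
  and by their inverses because the inverse of A is xI - A. The four coefficient functions are
  chosen before A and B; this uniformity is what yields a trace polynomial.\<close>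

lemma word_image_normal_form:
  "\<exists>P0 P1 P2 P3. poly3_fun P0 \<and> poly3_fun P1 \<and> poly3_fun P2 \<and> poly3_fun P3 \<and>
    (\<forall>A B i j. det A = 1 \<longrightarrow> det B = 1 \<longrightarrow> (let x = trace A; y = trace B; z = trace (A ** B) in
      word_image A B w $ i $ j = P0 x y z * mat 1 $ i $ j + P1 x y z * A $ i $ j
        + P2 x y z * B $ i $ j + P3 x y z * (A ** B) $ i $ j))"
proof (induction w)
  case Nil
  have "poly3_fun (\<lambda>x y z. of_int 0)" "poly3_fun (\<lambda>x y z. of_int 1)" by (rule poly3_fun_basic)+
  then show ?case
    by (intro exI[of _ "\<lambda>x y z. of_int 1"] exI[of _ "\<lambda>x y z. of_int 0"]) simp
next
  case (Cons s w)
  then obtain P0 P1 P2 P3 where P: "poly3_fun P0" "poly3_fun P1" "poly3_fun P2" "poly3_fun P3"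
    and eq: "\<And>A B i j. det A = 1 \<Longrightarrow> det B = 1 \<Longrightarrow>
      word_image A B w $ i $ j = P0 (trace A) (trace B) (trace (A ** B)) * mat 1 $ i $ j
        + P1 (trace A) (trace B) (trace (A ** B)) * A $ i $ j
        + P2 (trace A) (trace B) (trace (A ** B)) * B $ i $ j
        + P3 (trace A) (trace B) (trace (A ** B)) * (A ** B) $ i $ j"
    unfolding Let_def by metis
  have lin: "(M ** word_image A B w) $ i $ j = P0 (trace A) (trace B) (trace (A ** B)) * M $ i $ j
        + P1 (trace A) (trace B) (trace (A ** B)) * (M ** A) $ i $ j
        + P2 (trace A) (trace B) (trace (A ** B)) * (M ** B) $ i $ j
        + P3 (trace A) (trace B) (trace (A ** B)) * (M ** (A ** B)) $ i $ j"
    if "det A = 1" "det B = 1" for M A B :: "complex^2^2" and i j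
    using exhaust_2[of j]
    by (auto simp: matrix_mult_nth_2[of M] eq[OF that] algebra_simps)
  have inv: "(matrix_inv M ** N) $ i $ j = trace M * N $ i $ j - (M ** N) $ i $ j"
    if "det M = 1" for M N :: "complex^2^2" and i j
    using exhaust_2[of i] exhaust_2[of j]
    by (auto simp: matrix_mult_nth_2 matrix_inv_nth_2[OF that] algebra_simps)
  have z: "poly3_fun (\<lambda>x y z. - F x y z)" if "poly3_fun F" for F
    using poly3_fun_diff[OF poly3_fun_basic(1)[of 0] that] by simp
  \<comment> \<open>Left multiplication by B, and then by A, in the coordinates I, A, B, AB. The
    witnesses in the case distinction collect these coordinates.\<close>
  have lin_b: "(B ** word_image A B w) $ i $ j = P0 (trace A) (trace B) (trace (A ** B)) * B $ i $ j
        + P1 (trace A) (trace B) (trace (A ** B)) * (trace B * A $ i $ j + trace A * B $ i $ j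
          + (trace (A ** B) - trace A * trace B) * mat 1 $ i $ j - (A ** B) $ i $ j)
        + P2 (trace A) (trace B) (trace (A ** B)) * (trace B * B $ i $ j - mat 1 $ i $ j)
        + P3 (trace A) (trace B) (trace (A ** B)) * (A $ i $ j - trace A * mat 1 $ i $ j + trace (A ** B) * B $ i $ j)"
    if "det A = 1" "det B = 1" for A B i j
    unfolding lin[OF that] swap_nth_2[of B A] square_nth_2[OF that(2)] sandwich_nth_2[OF that(2)] by (rule refl)
  have lin_a: "(A ** word_image A B w) $ i $ j = P0 (trace A) (trace B) (trace (A ** B)) * A $ i $ j
        + P1 (trace A) (trace B) (trace (A ** B)) * (trace A * A $ i $ j - mat 1 $ i $ j)
        + P2 (trace A) (trace B) (trace (A ** B)) * (A ** B) $ i $ j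
        + P3 (trace A) (trace B) (trace (A ** B)) * (trace A * (A ** B) $ i $ j - B $ i $ j)"
    if "det A = 1" "det B = 1" for A B i j
    unfolding lin[OF that] square_nth_2[OF that(1)] mult_square_nth_2[OF that(1)] by (rule refl)
  note [simp] = eq inv Let_def
  show ?case
  proof (cases s)
    case Pos_a
    show ?thesis unfolding Pos_a
      by (intro exI[of _ "\<lambda>x y z. - P1 x y z"] exI[of _ "\<lambda>x y z. P0 x y z + x * P1 x y z"]
        exI[of _ "\<lambda>x y z. - P3 x y z"] exI[of _ "\<lambda>x y z. P2 x y z + x * P3 x y z"]
        conjI z P poly3_fun_add poly3_fun_mult poly3_fun_basic) (simp add: lin_a algebra_simps)
  next
    case Neg_a
    show ?thesis unfolding Neg_a
      by (intro exI[of _ "\<lambda>x y z. x * P0 x y z + P1 x y z"] exI[of _ "\<lambda>x y z. - P0 x y z"]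
        exI[of _ "\<lambda>x y z. x * P2 x y z + P3 x y z"] exI[of _ "\<lambda>x y z. - P2 x y z"]
        conjI z P poly3_fun_add poly3_fun_mult poly3_fun_basic) (simp add: lin_a algebra_simps)
  next
    case Pos_b
    show ?thesis unfolding Pos_b
      by (intro exI[of _ "\<lambda>x y z. (z - x * y) * P1 x y z - P2 x y z - x * P3 x y z"]
        exI[of _ "\<lambda>x y z. y * P1 x y z + P3 x y z"]
        exI[of _ "\<lambda>x y z. P0 x y z + x * P1 x y z + y * P2 x y z + z * P3 x y z"]
        exI[of _ "\<lambda>x y z. - P1 x y z"]
        conjI z P poly3_fun_add poly3_fun_diff poly3_fun_mult poly3_fun_basic)
        (simp add: lin_b algebra_simps)
  next
    case Neg_b
    show ?thesis unfolding Neg_b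
      by (intro exI[of _ "\<lambda>x y z. y * P0 x y z - ((z - x * y) * P1 x y z - P2 x y z - x * P3 x y z)"]
        exI[of _ "\<lambda>x y z. y * P1 x y z - (y * P1 x y z + P3 x y z)"]
        exI[of _ "\<lambda>x y z. y * P2 x y z - (P0 x y z + x * P1 x y z + y * P2 x y z + z * P3 x y z)"]
        exI[of _ "\<lambda>x y z. y * P3 x y z + P1 x y z"]
        conjI z P poly3_fun_add poly3_fun_diff poly3_fun_mult poly3_fun_basic)
        (simp add: lin_b algebra_simps)
  qed
qed

section \<open>Existence and uniqueness of the trace polynomial\<close>

lemma plus_inverse_surjective:
  fixes z :: complex
  obtains t where "t \<noteq> 0" "t + 1 / t = z"
proof -
  define s where "s = csqrt (z ^ 2 - 4)"
  define t where "t = (z + s) / 2"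
  have "s ^ 2 = z ^ 2 - 4" by (simp add: s_def)
  then have *: "t * (z - t) = 1"
    by (simp add: t_def field_simps power2_eq_square)
  then have "t \<noteq> 0" by auto
  moreover from * this have "t + 1 / t = z" by (simp add: field_simps)
  ultimately show thesis using that by blast
qed

text \<open>The matrices \<open>gen_A x\<close> and \<open>gen_B y t\<close> realise the traces \<open>x\<close>, \<open>y\<close> and \<open>z = t + 1/t\<close>, so that the
  growth in \<open>z\<close> is the growth in \<open>t\<close>.\<close>

definition gen_A :: "complex \<Rightarrow> complex^2^2" where "gen_A x = mat2 x (-1) 1 0"
definition gen_B :: "complex \<Rightarrow> complex \<Rightarrow> complex^2^2" where "gen_B y t = mat2 0 t (- 1 / t) y"

lemma gen_traces:
  assumes "t \<noteq> 0"
  shows "det (gen_A x) = 1" "det (gen_B y t) = 1" "trace (gen_A x) = x" "trace (gen_B y t) = y"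
    "trace (gen_A x ** gen_B y t) = t + 1 / t"
  using assms by (simp_all add: gen_A_def gen_B_def det_2 trace_2 matrix_mult_nth_2)

text \<open>Existence: in the trace of the normal form, I, A, B, AB contribute 2, x, y, z.
  Uniqueness: the pairs \<open>gen_A x\<close>, \<open>gen_B y t\<close> with t + 1/t = z realise
  every triple of traces, so two candidates agree as functions. Hence the description in
  \<open>trace_poly\<close> denotes.\<close>

lemma trace_poly:
  assumes "det A = 1" "det B = 1"
  shows "trace (word_image A B w) = poly3_eval (trace_poly w) (trace A) (trace B) (trace (A ** B))"
proof -
  let ?Q = "\<lambda>f. \<forall>A B :: complex^2^2. det A = 1 \<longrightarrow> det B = 1 \<longrightarrow>
     trace (word_image A B w) = poly3_eval f (trace A) (trace B) (trace (A ** B))"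
  obtain P0 P1 P2 P3 where P: "poly3_fun P0" "poly3_fun P1" "poly3_fun P2" "poly3_fun P3"
    and eq: "\<And>A B i j. det A = 1 \<Longrightarrow> det B = 1 \<Longrightarrow>
      word_image A B w $ i $ j = P0 (trace A) (trace B) (trace (A ** B)) * mat 1 $ i $ j
        + P1 (trace A) (trace B) (trace (A ** B)) * A $ i $ j
        + P2 (trace A) (trace B) (trace (A ** B)) * B $ i $ j
        + P3 (trace A) (trace B) (trace (A ** B)) * (A ** B) $ i $ j"
    using word_image_normal_form[of w] unfolding Let_def by metis
  have "poly3_fun (\<lambda>x y z. of_int 2 * P0 x y z + x * P1 x y z + y * P2 x y z + z * P3 x y z)"
    by (intro P poly3_fun_add poly3_fun_mult poly3_fun_basic)
  then obtain f where f: "\<And>x y z. 2 * P0 x y z + x * P1 x y z + y * P2 x y z + z * P3 x y z = poly3_eval f x y z"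
    unfolding poly3_fun_def by auto
  have tr: "(p0 * (mat 1 :: complex^2^2) $ 1 $ 1 + p1 * A $ 1 $ 1 + p2 * B $ 1 $ 1 + p3 * (A ** B) $ 1 $ 1)
      + (p0 * (mat 1 :: complex^2^2) $ 2 $ 2 + p1 * A $ 2 $ 2 + p2 * B $ 2 $ 2 + p3 * (A ** B) $ 2 $ 2)
      = 2 * p0 + trace A * p1 + trace B * p2 + trace (A ** B) * p3" for p0 p1 p2 p3 and A B :: "complex^2^2"
    by (simp add: trace_2 algebra_simps)
  have f': "?Q f"
    unfolding f[symmetric] trace_2[of "word_image _ _ _"] by (intro allI impI) (simp only: eq tr)
  have "g = f" if g: "?Q g" for g
  proof (rule poly3_eval_inject)
    fix x y z :: complex
    obtain t where t: "t \<noteq> 0" "t + 1 / t = z" using plus_inverse_surjective[of z] by blast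
    show "poly3_eval g x y z = poly3_eval f x y z"
      using g[rule_format, of "gen_A x" "gen_B y t"] f'[rule_format, of "gen_A x" "gen_B y t"]
      by (simp add: gen_traces[OF t(1)] t(2))
  qed
  with f' have "?Q (trace_poly w)"
    unfolding trace_poly_def by (rule theI[of ?Q])
  then show ?thesis using assms by blast
qed

section \<open>Products of Chebyshev polynomials\<close>

text \<open>A matrix M of determinant 1 and trace x satisfies M^k = U_k(x) M - U_(k-1)(x) I for k >=
  1. These are the Chebyshev polynomials of the second kind in x/2, with the index shifted by
  one.\<close>

fun cheb :: "nat \<Rightarrow> 'a::comm_ring_1 poly" where
  "cheb 0 = 0"
| "cheb (Suc 0) = 1"
| "cheb (Suc (Suc k)) = [:0, 1:] * cheb (Suc k) - cheb k"

text \<open>The Fibonacci polynomials. The plus sign allows natural coefficients, for which sizes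
  can be compared termwise.\<close>

fun abs_cheb :: "nat \<Rightarrow> 'a::comm_semiring_1 poly" where
  "abs_cheb 0 = 0"
| "abs_cheb (Suc 0) = 1"
| "abs_cheb (Suc (Suc k)) = [:0, 1:] * abs_cheb (Suc k) + abs_cheb k"

text \<open>\<open>U\<^sub>k(\<i>x) = \<i>\<^bsup>k-1\<^esup> |U\<^sub>k|(x)\<close>, with both sides multiplied by \<open>\<i>\<close> to cover \<open>k = 0\<close>.\<close>

lemma cheb_imaginary:
  "smult \<i> (pcompose (cheb k) [:0, \<i>:]) = smult (\<i> ^ k) (abs_cheb k :: complex poly)"
proof (induction k rule: cheb.induct)
  case (3 k)
  have "smult \<i> (pcompose (cheb (Suc (Suc k))) [:0, \<i>:])
    = [:0, \<i>:] * smult \<i> (pcompose (cheb (Suc k)) [:0, \<i>:]) - smult \<i> (pcompose (cheb k) [:0, \<i>:])"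
    by (simp add: pcompose_diff pcompose_mult pcompose_pCons smult_diff_right)
  also have "\<dots> = [:0, \<i>:] * smult (\<i> ^ Suc k) (abs_cheb (Suc k)) - smult (\<i> ^ k) (abs_cheb k)"
    using 3 by simp
  also have "\<dots> = smult (\<i> ^ Suc (Suc k)) (abs_cheb (Suc (Suc k)))"
    by (simp add: smult_add_right mult.commute[of _ \<i>])
  finally show ?case .
qed (auto simp: pcompose_1)

lemma coeff_abs_cheb_of_nat:
  "coeff (abs_cheb k :: complex poly) i = of_nat (coeff (abs_cheb k) i)"
proof (induction k arbitrary: i rule: abs_cheb.induct)
  case (3 k)
  then show ?case by (cases i) (simp_all add: coeff_pCons)
qed (auto simp: coeff_1)

text \<open>By \<open>cheb_imaginary\<close> the substitution turns each factor into a scalar of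
  modulus 1 times \<open>abs_cheb k\<close>, while it multiplies the coefficient of index i by a
  power of the imaginary unit. Moduli of coefficients therefore pass through the product without
  cancellation.\<close>

lemma norm_coeff_cheb_prod:
  "cmod (coeff (\<Prod>k\<leftarrow>ks. cheb k) i) = real (coeff (\<Prod>k\<leftarrow>ks. abs_cheb k) i)"
proof -
  have 1: "\<exists>c. cmod c = 1 \<and> pcompose (\<Prod>k\<leftarrow>ks. cheb k) [:0, \<i>:] = smult c (\<Prod>k\<leftarrow>ks. abs_cheb k :: complex poly)"
  proof (induction ks)
    case (Cons k ks)
    then obtain c where c: "cmod c = 1" "pcompose (\<Prod>k\<leftarrow>ks. cheb k) [:0, \<i>:] = smult c (\<Prod>k\<leftarrow>ks. abs_cheb k :: complex poly)"
      by blast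
    have "smult (-\<i>) (smult \<i> (pcompose (cheb k) [:0, \<i>:])) = smult (-\<i>) (smult (\<i> ^ k) (abs_cheb k :: complex poly))"
      by (simp only: cheb_imaginary)
    then have "pcompose (cheb k) [:0, \<i>:] = smult (-\<i> * \<i> ^ k) (abs_cheb k :: complex poly)" by simp
    with c have "pcompose (\<Prod>k\<leftarrow>k#ks. cheb k) [:0, \<i>:] = smult ((-\<i> * \<i> ^ k) * c) (\<Prod>k\<leftarrow>k#ks. abs_cheb k :: complex poly)"
      by (simp add: pcompose_mult mult_ac)
    moreover have "cmod ((-\<i> * \<i> ^ k) * c) = 1" using c by (simp add: norm_mult norm_power)
    ultimately show ?case by blast
  qed (simp add: pcompose_1 exI[of _ 1])
  have 2: "coeff (\<Prod>k\<leftarrow>ks. abs_cheb k :: complex poly) i = of_nat (coeff (\<Prod>k\<leftarrow>ks. abs_cheb k) i)" for i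
  proof (induction ks arbitrary: i)
    case (Cons k ks)
    then show ?case by (simp add: coeff_mult coeff_abs_cheb_of_nat)
  qed (simp add: coeff_1)
  from 1 obtain c where c: "cmod c = 1"
    "pcompose (\<Prod>k\<leftarrow>ks. cheb k) [:0, \<i>:] = smult c (\<Prod>k\<leftarrow>ks. abs_cheb k :: complex poly)"
    by blast
  have "cmod (coeff (pcompose (\<Prod>k\<leftarrow>ks. cheb k) [:0, \<i>:]) i) = cmod (coeff (\<Prod>k\<leftarrow>ks. cheb k) i)"
    by (simp add: coeff_pcompose_linear norm_mult norm_power)
  then show ?thesis using c by (simp add: norm_mult 2)
qed

section \<open>Coefficientwise bounds for products\<close>

definition coeff_le :: "nat poly \<Rightarrow> nat poly \<Rightarrow> bool" (infix "\<preceq>" 50) where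
  "p \<preceq> q \<longleftrightarrow> (\<forall>i. coeff p i \<le> coeff q i)"

lemma coeff_le_refl [simp]: "p \<preceq> p"
  and coeff_le_trans [trans]: "p \<preceq> q \<Longrightarrow> q \<preceq> r \<Longrightarrow> p \<preceq> r"
  and coeff_le_add: "p \<preceq> q \<Longrightarrow> p' \<preceq> q' \<Longrightarrow> p + p' \<preceq> q + q'"
  unfolding coeff_le_def by (auto intro: order.trans add_mono)

text \<open>Monotonicity holds because the coefficients are natural numbers; it lets bounds be
  proved factor by factor.\<close>

lemma coeff_le_mult: "p \<preceq> q \<Longrightarrow> p' \<preceq> q' \<Longrightarrow> p * p' \<preceq> q * q'"
  unfolding coeff_le_def coeff_mult by (auto intro!: sum_mono mult_mono)

definition poly_X :: "nat poly" where "poly_X = [:0, 1:]"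
definition one_plus_X2 :: "nat poly" where "one_plus_X2 = 1 + poly_X ^ 2"

lemma coeff_X_mult: "coeff (poly_X * p) i = (case i of 0 \<Rightarrow> 0 | Suc j \<Rightarrow> coeff p j)"
  by (simp add: poly_X_def coeff_pCons mult_pCons_left del: One_nat_def)

lemma coeff_X_power_mult: "coeff (poly_X ^ n * p) (n + i) = coeff p i"
  by (induction n) (simp_all add: coeff_X_mult mult.assoc)

lemma abs_cheb_Suc_Suc: "abs_cheb (Suc (Suc k)) = poly_X * abs_cheb (Suc k) + abs_cheb k"
  by (simp add: poly_X_def)

text \<open>Multiplication by 1 + X^2 acts on the even coefficients as Pascal's rule.\<close>

lemma coeff_X2_power: "coeff (one_plus_X2 ^ N) (2 * i) = N choose i"
proof (induction N arbitrary: i)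
  case 0
  then show ?case by (cases i) (auto simp: coeff_1)
next
  case (Suc N)
  have "one_plus_X2 ^ Suc N = one_plus_X2 ^ N + poly_X * (poly_X * one_plus_X2 ^ N)"
    by (simp add: one_plus_X2_def power2_eq_square algebra_simps)
  then have "coeff (one_plus_X2 ^ Suc N) (2 * i) = coeff (one_plus_X2 ^ N) (2 * i) + (if i = 0 then 0 else coeff (one_plus_X2 ^ N) (2 * (i - 1)))"
    by (cases i) (simp_all add: coeff_X_mult)
  then show ?case unfolding Suc.IH by (cases i) simp_all
qed

lemma X_power_le_abs_cheb: "poly_X ^ k \<preceq> abs_cheb (Suc k)"
proof (induction k)
  case (Suc k)
  have "poly_X ^ Suc k + 0 \<preceq> poly_X * abs_cheb (Suc k) + abs_cheb k"
    unfolding power_Suc by (intro coeff_le_add coeff_le_mult Suc) (simp_all add: coeff_le_def)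
  then show ?case by (simp only: abs_cheb_Suc_Suc add_0_right)
qed simp

lemma abs_cheb_3: "abs_cheb 3 = one_plus_X2"
  by (simp add: numeral_3_eq_3 abs_cheb_Suc_Suc one_plus_X2_def power2_eq_square add.commute del: abs_cheb.simps(3))

text \<open>A factor with k = 3 equals 1 + X^2, and any other factor is bounded below by its leading
  term X^(k-1). The second conjunct makes the subtraction in the exponent exact: each 3 contributes
  2 to the degree.\<close>

lemma abs_cheb_prod_ge:
  assumes "\<forall>k\<in>set ks. k \<ge> 1"
  shows "poly_X ^ ((\<Sum>k\<leftarrow>ks. k - 1) - 2 * count_list ks 3) * one_plus_X2 ^ count_list ks 3 \<preceq> (\<Prod>k\<leftarrow>ks. abs_cheb k)
     \<and> 2 * count_list ks 3 \<le> (\<Sum>k\<leftarrow>ks. k - 1)"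
  using assms
proof (induction ks)
  case (Cons k ks)
  let ?c = "count_list ks 3" and ?d = "\<Sum>k\<leftarrow>ks. k - 1"
  have IH: "poly_X ^ (?d - 2 * ?c) * one_plus_X2 ^ ?c \<preceq> (\<Prod>k\<leftarrow>ks. abs_cheb k)" "2 * ?c \<le> ?d" using Cons by auto
  show ?case
  proof (cases "k = 3")
    case True
    have "one_plus_X2 * (poly_X ^ (?d - 2 * ?c) * one_plus_X2 ^ ?c) \<preceq> abs_cheb 3 * (\<Prod>k\<leftarrow>ks. abs_cheb k)"
      by (intro coeff_le_mult IH) (simp add: abs_cheb_3)
    then show ?thesis using True IH by (simp add: mult_ac)
  next
    case False
    have "poly_X ^ (k - 1) * (poly_X ^ (?d - 2 * ?c) * one_plus_X2 ^ ?c) \<preceq> abs_cheb k * (\<Prod>k\<leftarrow>ks. abs_cheb k)"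
      using X_power_le_abs_cheb[of "k - 1"] Cons.prems by (intro coeff_le_mult IH) simp
    moreover have "poly_X ^ (k - 1) * (poly_X ^ (?d - 2 * ?c) * one_plus_X2 ^ ?c) = poly_X ^ (k - 1 + ?d - 2 * ?c) * one_plus_X2 ^ ?c"
      unfolding mult.assoc[symmetric] power_add[symmetric] using IH by simp
    ultimately show ?thesis using False IH by simp
  qed
qed simp

text \<open>The shift by X^(k+1) moves the top term X^(k-1) to X^(2k), the top term of (1 + X^2)^k.
  With this alignment the recursion reproduces itself, using X^2 + 1 as the common factor.\<close>

lemma abs_cheb_le: "poly_X ^ Suc k * abs_cheb k \<preceq> one_plus_X2 ^ k"
proof (induction k rule: abs_cheb.induct)
  case 2
  have "0 + poly_X ^ 2 \<preceq> one_plus_X2"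
    unfolding one_plus_X2_def by (intro coeff_le_add) (simp_all add: coeff_le_def)
  then show ?case by (simp add: power2_eq_square)
next
  case (3 k)
  have poly_X: "poly_X ^ 2 \<preceq> one_plus_X2"
    unfolding one_plus_X2_def by (simp add: coeff_le_def)
  have "poly_X ^ Suc (Suc (Suc k)) * abs_cheb (Suc (Suc k))
    = poly_X ^ 2 * (poly_X ^ Suc (Suc k) * abs_cheb (Suc k)) + poly_X ^ 2 * (poly_X ^ Suc k * abs_cheb k)"
    unfolding abs_cheb_Suc_Suc by (simp only: power2_eq_square power_Suc distrib_left mult_ac)
  also have "\<dots> \<preceq> poly_X ^ 2 * one_plus_X2 ^ Suc k + one_plus_X2 * one_plus_X2 ^ k"
    by (intro coeff_le_add coeff_le_mult 3 poly_X coeff_le_refl)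
  also have "\<dots> = one_plus_X2 ^ Suc (Suc k)"
    unfolding one_plus_X2_def by (simp only: power_Suc distrib_right distrib_left mult_1 mult_ac add_ac)
  finally show ?case .
qed (simp add: coeff_le_def)

lemma abs_cheb_prod_le: "poly_X ^ (\<Sum>k\<leftarrow>ks. Suc k) * (\<Prod>k\<leftarrow>ks. abs_cheb k) \<preceq> one_plus_X2 ^ sum_list ks"
proof (induction ks)
  case (Cons k ks)
  have "poly_X ^ (\<Sum>k\<leftarrow>k#ks. Suc k) * (\<Prod>k\<leftarrow>k#ks. abs_cheb k)
    = (poly_X ^ Suc k * abs_cheb k) * (poly_X ^ (\<Sum>k\<leftarrow>ks. Suc k) * (\<Prod>k\<leftarrow>ks. abs_cheb k))"
    by (simp only: list.map sum_list.Cons prod_list.Cons power_add mult_ac)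
  also have "\<dots> \<preceq> one_plus_X2 ^ k * one_plus_X2 ^ sum_list ks"
    by (intro coeff_le_mult abs_cheb_le Cons)
  finally show ?case by (simp only: sum_list.Cons power_add)
qed simp

lemma coeff_abs_cheb_prod_ge:
  assumes "\<forall>k\<in>set ks. k \<ge> 1"
  shows "count_list ks 3 choose i \<le> coeff (\<Prod>k\<leftarrow>ks. abs_cheb k) ((\<Sum>k\<leftarrow>ks. k - 1) - 2 * count_list ks 3 + 2 * i)"
  using abs_cheb_prod_ge[OF assms] coeff_X2_power[of "count_list ks 3" i]
    coeff_X_power_mult[of "(\<Sum>k\<leftarrow>ks. k - 1) - 2 * count_list ks 3" "one_plus_X2 ^ count_list ks 3" "2 * i"]
  unfolding coeff_le_def by metis

text \<open>Here j counts steps of two below the top degree. After the shift of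
  \<open>abs_cheb_prod_le\<close> the index is twice \<open>sum_list ks - j\<close>, and symmetry of
  the binomial coefficient gives j as lower index.\<close>

lemma coeff_abs_cheb_prod_le:
  assumes "\<forall>k\<in>set ks. k \<ge> 1" "i + 2 * j = (\<Sum>k\<leftarrow>ks. k - 1)"
  shows "coeff (\<Prod>k\<leftarrow>ks. abs_cheb k) i \<le> sum_list ks choose j"
proof -
  have len: "length ks \<le> sum_list ks \<and> (\<Sum>k\<leftarrow>ks. k - 1) + length ks = sum_list ks \<and> (\<Sum>k\<leftarrow>ks. Suc k) = sum_list ks + length ks"
    using assms(1) by (induction ks) auto
  have "coeff (\<Prod>k\<leftarrow>ks. abs_cheb k) i = coeff (poly_X ^ (\<Sum>k\<leftarrow>ks. Suc k) * (\<Prod>k\<leftarrow>ks. abs_cheb k)) ((\<Sum>k\<leftarrow>ks. Suc k) + i)"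
    by (simp only: coeff_X_power_mult)
  also have "\<dots> \<le> coeff (one_plus_X2 ^ sum_list ks) ((\<Sum>k\<leftarrow>ks. Suc k) + i)"
    using abs_cheb_prod_le unfolding coeff_le_def by blast
  also have "(\<Sum>k\<leftarrow>ks. Suc k) + i = 2 * (sum_list ks - j)" using len assms(2) by linarith
  also have "coeff (one_plus_X2 ^ sum_list ks) (2 * (sum_list ks - j)) = sum_list ks choose j"
    using len assms(2) unfolding coeff_X2_power by (intro binomial_symmetric[symmetric]) linarith
  finally show ?thesis .
qed

section \<open>The leading coefficient in z\<close>

type_synonym syllable_pair = "(letter \<times> nat) \<times> (letter \<times> nat)"

definition syllable_word :: "syllable_pair \<Rightarrow> word" where
  "syllable_word p = replicate (snd (fst p)) (fst (fst p)) @ replicate (snd (snd p)) (fst (snd p))"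

definition syllable_pairs :: "syllable_pair set" where
  "syllable_pairs = ({Pos_a, Neg_a} \<times> {1..}) \<times> ({Pos_b, Neg_b} \<times> {1..})"

text \<open>After division by t^m the matrix tends to one with zero first column and second column
  (a, b). Such limits are closed under products, and their lower right entries multiply, so b can be
  followed along a word.\<close>

definition lead :: "nat \<Rightarrow> (complex \<Rightarrow> complex^2^2) \<Rightarrow> complex \<Rightarrow> complex \<Rightarrow> bool" where
  "lead m F a b \<longleftrightarrow>
     ((\<lambda>t. F t $ 1 $ 1 / t ^ m) \<longlongrightarrow> 0) at_infinity \<and> ((\<lambda>t. F t $ 1 $ 2 / t ^ m) \<longlongrightarrow> a) at_infinity \<and>
     ((\<lambda>t. F t $ 2 $ 1 / t ^ m) \<longlongrightarrow> 0) at_infinity \<and> ((\<lambda>t. F t $ 2 $ 2 / t ^ m) \<longlongrightarrow> b) at_infinity"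

lemma lead_mult:
  assumes "lead m F a b" "lead m' G a' b'"
  shows "lead (m + m') (\<lambda>t. F t ** G t) (a * b') (b * b')"
proof -
  have eq: "(F t ** G t) $ i $ j / t ^ (m + m') = (F t $ i $ 1 / t ^ m) * (G t $ 1 $ j / t ^ m')
      + (F t $ i $ 2 / t ^ m) * (G t $ 2 $ j / t ^ m')" for t i j
    by (simp add: matrix_mult_nth_2 power_add add_divide_distrib)
  have F: "((\<lambda>t. F t $ 1 $ 1 / t ^ m) \<longlongrightarrow> 0) at_infinity" "((\<lambda>t. F t $ 1 $ 2 / t ^ m) \<longlongrightarrow> a) at_infinity"
     "((\<lambda>t. F t $ 2 $ 1 / t ^ m) \<longlongrightarrow> 0) at_infinity" "((\<lambda>t. F t $ 2 $ 2 / t ^ m) \<longlongrightarrow> b) at_infinity"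
   and G: "((\<lambda>t. G t $ 1 $ 1 / t ^ m') \<longlongrightarrow> 0) at_infinity" "((\<lambda>t. G t $ 1 $ 2 / t ^ m') \<longlongrightarrow> a') at_infinity"
     "((\<lambda>t. G t $ 2 $ 1 / t ^ m') \<longlongrightarrow> 0) at_infinity" "((\<lambda>t. G t $ 2 $ 2 / t ^ m') \<longlongrightarrow> b') at_infinity"
    using assms unfolding lead_def by auto
  show ?thesis
    unfolding lead_def eq
    using tendsto_add[OF tendsto_mult[OF F(1) G(1)] tendsto_mult[OF F(2) G(3)]]
      tendsto_add[OF tendsto_mult[OF F(1) G(2)] tendsto_mult[OF F(2) G(4)]]
      tendsto_add[OF tendsto_mult[OF F(3) G(1)] tendsto_mult[OF F(4) G(3)]]
      tendsto_add[OF tendsto_mult[OF F(3) G(2)] tendsto_mult[OF F(4) G(4)]]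
    by simp
qed

text \<open>Multiplying by M once more and using M^2 = tr(M) M - I reproduces the recursion of
  \<open>cheb\<close>.\<close>

lemma word_image_replicate:
  assumes "det (letter_image A B s) = 1"
  shows "word_image A B (replicate (Suc k) s) $ i $ j
    = poly (cheb (Suc k)) (trace (letter_image A B s)) * letter_image A B s $ i $ j
      - poly (cheb k) (trace (letter_image A B s)) * mat 1 $ i $ j"
proof (induction k arbitrary: i j)
  case 0
  then show ?case by simp
next
  case (Suc k)
  let ?M = "letter_image A B s"
  let ?u = "\<lambda>k. poly (cheb k) (trace ?M)"
  have "word_image A B (replicate (Suc (Suc k)) s) $ i $ j
    = ?u (Suc k) * (?M ** ?M) $ i $ j - ?u k * ?M $ i $ j"
    unfolding replicate_Suc[of "Suc k"] word_image_Cons matrix_mult_nth_2[of _ _ i j] Suc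
    using exhaust_2[of j] by (auto simp: algebra_simps)
  then show ?case
    by (simp add: square_nth_2[OF assms] algebra_simps)
qed

text \<open>The power of a does not depend on t and has lower left entry U_k(x) up to sign. In the
  power of b only the upper right entry grows like t, with factor U_l(y) up to sign. Their product
  after division by t thus has the limit shape of \<open>lead\<close>. The sign is fixed before x
  and y, so it is a constant factor of the polynomial.\<close>

lemma lead_syllable:
  assumes "p \<in> syllable_pairs"
  shows "\<exists>\<sigma>\<in>{1, -1}. \<forall>x y. \<exists>a. lead 1 (\<lambda>t. word_image (gen_A x) (gen_B y t) (syllable_word p)) a
    (\<sigma> * poly (cheb (snd (fst p))) x * poly (cheb (snd (snd p))) y)"
proof -
  from assms obtain s k r l where p: "p = ((s, Suc k), (r, Suc l))" and s: "s = Pos_a \<or> s = Neg_a"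
    and r: "r = Pos_b \<or> r = Neg_b"
    unfolding syllable_pairs_def by (cases p) (auto elim!: Suc_le_D[THEN exE])
  define \<sigma> \<tau> :: complex where "\<sigma> = (if s = Pos_a then 1 else -1)" and "\<tau> = (if r = Pos_b then 1 else -1)"
  have "\<exists>a. lead 1 (\<lambda>t. word_image (gen_A x) (gen_B y t) (syllable_word p)) a
    (\<sigma> * \<tau> * poly (cheb (snd (fst p))) x * poly (cheb (snd (snd p))) y)" for x y
  proof -
    let ?A = "gen_A x" and ?B = "gen_B y"
    let ?u = "\<lambda>k. poly (cheb k) x" and ?v = "\<lambda>k. poly (cheb k) y"
    have inv: "matrix_inv ?A = mat2 0 1 (-1) x" "t \<noteq> 0 \<Longrightarrow> matrix_inv (?B t) = mat2 y (-t) (1 / t) 0" for t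
      by (subst matrix_inv_2; simp add: gen_A_def gen_B_def det_2)+
    \<comment> \<open>Row i of the power of a. The second generator is set to \<open>mat 1\<close>,
      which is harmless since no letter of type b occurs, and makes the independence of t
      visible.\<close>
    define c where "c i = word_image ?A (mat 1) (replicate (Suc k) s) $ i" for i
    have A: "word_image ?A N (replicate m s) = word_image ?A N' (replicate m s)" for N N' m
      using s by (induction m) auto
    have detA: "det (letter_image ?A N s) = 1" "trace (letter_image ?A N s) = x"
      "letter_image ?A N s $ 2 $ 1 = \<sigma>" for N
      using s by (auto simp: inv(1) \<sigma>_def) (auto simp: gen_A_def det_2 trace_2)
    have c21: "c 2 $ 1 = \<sigma> * ?u (Suc k)"
      unfolding c_def word_image_replicate[OF detA(1)] detA by simp
    have nz: "eventually (\<lambda>t::complex. t \<noteq> 0) at_infinity"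
      by (simp add: eventually_not_equal_at_infinity)
    have linf: "((\<lambda>t::complex. C / t) \<longlongrightarrow> 0) at_infinity" for C
      using tendsto_mult[OF tendsto_const[of C] tendsto_inverse_0] by (simp add: divide_inverse)
    define D where "D t = word_image ?A (?B t) (replicate (Suc l) r)" for t
    have D: "D t $ i $ j = ?v (Suc l) * letter_image ?A (?B t) r $ i $ j - ?v l * mat 1 $ i $ j" if "t \<noteq> 0" for t i j
    proof -
      have "det (letter_image ?A (?B t) r) = 1" "trace (letter_image ?A (?B t) r) = y"
        using r gen_traces[OF that] by (auto simp: det_matrix_inv_2 trace_matrix_inv_2)
      then show ?thesis unfolding D_def by (simp only: word_image_replicate)
    qed
    have linf2: "((\<lambda>t::complex. C / t / t) \<longlongrightarrow> 0) at_infinity" for C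
      using tendsto_mult[OF linf[of C] tendsto_inverse_0] by (simp add: divide_inverse mult.assoc)
    \<comment> \<open>Closed form of the entries of the power of b for t different from 0: order t
      in the upper right, order 1/t in the lower left, constant on the diagonal.\<close>
    define e where "e i j t = (if i = 1 \<and> j = 2 then \<tau> * ?v (Suc l) * t
        else if i = 2 \<and> j = 1 then - \<tau> * ?v (Suc l) / t
        else if (i = 1) = (r = Pos_b) then - ?v l else ?v (Suc l) * y - ?v l)" for i j :: 2 and t
    have De: "D t $ i $ j = e i j t" if "t \<noteq> 0" for t i j
    proof -
      have "letter_image ?A (?B t) r = (if r = Pos_b then mat2 0 t (- 1 / t) y else mat2 y (- t) (1 / t) 0)"
        using r inv(2)[OF that] by (auto simp: gen_B_def)
      then show ?thesis
        using r exhaust_2[of i] exhaust_2[of j] by (auto simp: D[OF that] e_def \<tau>_def)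
    qed
    have De_lim: "((\<lambda>t. D t $ i $ j / t) \<longlongrightarrow> L) at_infinity" if "((\<lambda>t. e i j t / t) \<longlongrightarrow> L) at_infinity" for i j L
      by (rule Lim_transform_eventually[OF that eventually_mono[OF nz]]) (simp add: De)
    have "((\<lambda>t. e 1 2 t / t) \<longlongrightarrow> \<tau> * ?v (Suc l)) at_infinity"
      by (rule Lim_transform_eventually[OF tendsto_const eventually_mono[OF nz]]) (simp add: e_def)
    note lim12 = De_lim[OF this]
    have lim11: "((\<lambda>t. D t $ 1 $ 1 / t) \<longlongrightarrow> 0) at_infinity"
      and lim22: "((\<lambda>t. D t $ 2 $ 2 / t) \<longlongrightarrow> 0) at_infinity"
      by (intro De_lim; simp only: e_def; simp add: linf del: cheb.simps)+
    have lim21: "((\<lambda>t. D t $ 2 $ 1 / t) \<longlongrightarrow> 0) at_infinity"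
      using linf2[of "- \<tau> * ?v (Suc l)"] by (intro De_lim) (simp add: e_def del: cheb.simps)
    have "word_image ?A (?B t) (syllable_word p) $ i $ j = c i $ 1 * D t $ 1 $ j + c i $ 2 * D t $ 2 $ j" for t i j
      unfolding p syllable_word_def word_image_append c_def D_def fst_conv snd_conv matrix_mult_nth_2
      by (simp only: A[of "?B t" "Suc k" "mat 1"])
    then have eq: "word_image ?A (?B t) (syllable_word p) $ i $ j / t ^ 1
        = c i $ 1 * (D t $ 1 $ j / t) + c i $ 2 * (D t $ 2 $ j / t)" for t i j
      by (simp add: add_divide_distrib)
    have "lead 1 (\<lambda>t. word_image ?A (?B t) (syllable_word p)) (c 1 $ 1 * (\<tau> * ?v (Suc l))) (c 2 $ 1 * (\<tau> * ?v (Suc l)))"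
      unfolding lead_def eq
      using tendsto_add[OF tendsto_mult_left[OF lim11, of "c i $ 1" for i] tendsto_mult_left[OF lim21, of "c i $ 2" for i]]
        tendsto_add[OF tendsto_mult_left[OF lim12, of "c i $ 1" for i] tendsto_mult_left[OF lim22, of "c i $ 2" for i]]
      by (simp del: cheb.simps)
    then show ?thesis
      unfolding c21 by (intro exI) (simp add: p mult_ac del: cheb.simps)
  qed
  moreover have "\<sigma> * \<tau> \<in> {1, -1}" by (auto simp: \<sigma>_def \<tau>_def)
  ultimately show ?thesis by blast
qed

lemma lead_syllables:
  assumes "ps \<noteq> []" "set ps \<subseteq> syllable_pairs"
  shows "\<exists>\<sigma>\<in>{1, -1}. \<forall>x y. \<exists>a.
    lead (length ps) (\<lambda>t. word_image (gen_A x) (gen_B y t) (concat (map syllable_word ps))) a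
      (\<sigma> * poly (\<Prod>p\<leftarrow>ps. cheb (snd (fst p))) x * poly (\<Prod>p\<leftarrow>ps. cheb (snd (snd p))) y)"
  using assms
proof (induction ps rule: list_nonempty_induct)
  case (single p)
  then show ?case using lead_syllable[of p] by simp
next
  case (cons p ps)
  then obtain \<sigma> where \<sigma>: "\<sigma> \<in> {1, -1}" and IH: "\<And>x y. \<exists>a.
    lead (length ps) (\<lambda>t. word_image (gen_A x) (gen_B y t) (concat (map syllable_word ps))) a
      (\<sigma> * poly (\<Prod>p\<leftarrow>ps. cheb (snd (fst p))) x * poly (\<Prod>p\<leftarrow>ps. cheb (snd (snd p))) y)"
    using cons.IH cons.prems unfolding list.set(2) insert_subset by blast
  obtain \<tau> where \<tau>: "\<tau> \<in> {1, -1}" and p: "\<And>x y. \<exists>a. lead 1 (\<lambda>t. word_image (gen_A x) (gen_B y t) (syllable_word p)) a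
    (\<tau> * poly (cheb (snd (fst p))) x * poly (cheb (snd (snd p))) y)"
    using lead_syllable[of p] cons.prems unfolding list.set(2) insert_subset by blast
  have "\<exists>a. lead (length (p # ps)) (\<lambda>t. word_image (gen_A x) (gen_B y t) (concat (map syllable_word (p # ps)))) a
      (\<tau> * \<sigma> * poly (\<Prod>p\<leftarrow>p # ps. cheb (snd (fst p))) x * poly (\<Prod>p\<leftarrow>p # ps. cheb (snd (snd p))) y)" for x y
  proof -
    obtain a b where "lead 1 (\<lambda>t. word_image (gen_A x) (gen_B y t) (syllable_word p)) a
        (\<tau> * poly (cheb (snd (fst p))) x * poly (cheb (snd (snd p))) y)"
      "lead (length ps) (\<lambda>t. word_image (gen_A x) (gen_B y t) (concat (map syllable_word ps))) b
      (\<sigma> * poly (\<Prod>p\<leftarrow>ps. cheb (snd (fst p))) x * poly (\<Prod>p\<leftarrow>ps. cheb (snd (snd p))) y)"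
      using p[of x y] IH[of x y] by blast
    from lead_mult[OF this] show ?thesis
      by (intro exI) (simp add: word_image_append mult_ac)
  qed
  moreover have "\<tau> * \<sigma> \<in> {1, -1}" using \<sigma> \<tau> by auto
  ultimately show ?case by blast
qed

text \<open>In the trace the upper left entry is negligible against t^m, so the lower right entry of
  \<open>lead_syllables\<close> gives the limit. As z = t + 1/t is asymptotic to t, this is also the
  limit after division by z^m, and \<open>lookup_eq_limit\<close> separates the x- and
  y-coefficients.\<close>

lemma lookup_trace_poly:
  assumes "ps \<noteq> []" "set ps \<subseteq> syllable_pairs"
    and "\<And>A B. det A = 1 \<Longrightarrow> det B = 1 \<Longrightarrow>
      trace (word_image A B w) = trace (word_image A B (concat (map syllable_word ps)))"
  shows "\<bar>Poly_Mapping.lookup (trace_poly w) (i, j, length ps)\<bar>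
    = int (coeff (\<Prod>k\<leftarrow>map (snd \<circ> fst) ps. abs_cheb k) i * coeff (\<Prod>k\<leftarrow>map (snd \<circ> snd) ps. abs_cheb k) j)"
proof -
  obtain \<sigma> :: complex where \<sigma>: "\<sigma> \<in> {1, -1}" and lead: "\<And>x y. \<exists>a.
    lead (length ps) (\<lambda>t. word_image (gen_A x) (gen_B y t) (concat (map syllable_word ps))) a
      (\<sigma> * poly (\<Prod>p\<leftarrow>ps. cheb (snd (fst p))) x * poly (\<Prod>p\<leftarrow>ps. cheb (snd (snd p))) y)"
    using lead_syllables[OF assms(1,2)] by blast
  define g :: "complex \<Rightarrow> complex" where "g t = t + 1 / t" for t
  have nz: "eventually (\<lambda>t::complex. t \<noteq> 0) at_infinity"
    by (simp add: eventually_not_equal_at_infinity)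
  have inv0: "((\<lambda>t::complex. 1 / t) \<longlongrightarrow> 0) at_infinity"
    unfolding divide_inverse mult_1_left by (rule tendsto_inverse_0)
  have g: "filterlim g at_infinity at_infinity"
    unfolding g_def using tendsto_add_filterlim_at_infinity'[OF filterlim_ident inv0] .
  have "((\<lambda>t. 1 / (1 + 1 / t * (1 / t))) \<longlongrightarrow> 1 / (1 + 0 * 0)) (at_infinity :: complex filter)"
    by (intro tendsto_intros inv0) simp
  moreover have "eventually (\<lambda>t. 1 / (1 + 1 / t * (1 / t)) = t / g t) at_infinity"
    using nz
  proof eventually_elim
    case (elim t)
    have "g t = t * (1 + 1 / t * (1 / t))" using elim by (simp add: g_def distrib_left)
    then show ?case using elim by simp
  qed
  ultimately have tg: "((\<lambda>t. t / g t) \<longlongrightarrow> 1) at_infinity"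
    by (simp add: Lim_transform_eventually)
  have lim: "((\<lambda>t. poly3_eval (trace_poly w) x y (g t) / g t ^ length ps) \<longlongrightarrow>
    poly (smult \<sigma> (\<Prod>p\<leftarrow>ps. cheb (snd (fst p)))) x * poly (\<Prod>p\<leftarrow>ps. cheb (snd (snd p))) y) at_infinity" for x y
  proof -
    let ?W = "\<lambda>t. word_image (gen_A x) (gen_B y t) (concat (map syllable_word ps))"
    from lead[of x y] have "((\<lambda>t. (?W t $ 1 $ 1 / t ^ length ps + ?W t $ 2 $ 2 / t ^ length ps) * (t / g t) ^ length ps)
      \<longlongrightarrow> (0 + \<sigma> * poly (\<Prod>p\<leftarrow>ps. cheb (snd (fst p))) x * poly (\<Prod>p\<leftarrow>ps. cheb (snd (snd p))) y) * 1 ^ length ps) at_infinity"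
      unfolding lead_def by (intro tendsto_intros tg) auto
    moreover have "eventually (\<lambda>t. (?W t $ 1 $ 1 / t ^ length ps + ?W t $ 2 $ 2 / t ^ length ps) * (t / g t) ^ length ps
      = poly3_eval (trace_poly w) x y (g t) / g t ^ length ps) at_infinity"
      using nz
    proof eventually_elim
      case (elim t)
      note G = gen_traces[OF elim]
      have ev: "poly3_eval (trace_poly w) x y (g t) = ?W t $ 1 $ 1 + ?W t $ 2 $ 2"
        using trace_poly[OF G(1) G(2), of x y w] assms(3)[OF G(1) G(2), of x y]
        by (simp add: G g_def trace_2[of "?W t"])
      \<comment> \<open>The case G = 0 is covered by division by zero being 0, so the values t with
        t + 1/t = 0 need no exclusion.\<close>
      have key: "(a / T + b / T) * (T / G) = (a + b) / G" if "T \<noteq> 0" for a b T G :: complex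
        using that by (cases "G = 0") (simp_all add: field_simps)
      have "t ^ length ps \<noteq> 0" using elim by simp
      from key[OF this] show ?case using ev by (simp only: power_divide)
    qed
    ultimately show ?thesis
      by (simp add: Lim_transform_eventually)
  qed
  have nb: "(at_infinity :: complex filter) \<noteq> bot" by (rule trivial_limit_at_infinity)
  have "complex_of_int (Poly_Mapping.lookup (trace_poly w) (i, j, length ps))
    = \<sigma> * coeff (\<Prod>k\<leftarrow>map (snd \<circ> fst) ps. cheb k) i * coeff (\<Prod>k\<leftarrow>map (snd \<circ> snd) ps. cheb k) j"
    using lookup_eq_limit[OF g nb lim] by (simp add: comp_def)
  then have "cmod (complex_of_int (Poly_Mapping.lookup (trace_poly w) (i, j, length ps)))
    = real (coeff (\<Prod>k\<leftarrow>map (snd \<circ> fst) ps. abs_cheb k) i) * real (coeff (\<Prod>k\<leftarrow>map (snd \<circ> snd) ps. abs_cheb k) j)"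
    using \<sigma> by (auto simp: norm_mult norm_coeff_cheb_prod simp del: map_map)
  then have "real_of_int \<bar>Poly_Mapping.lookup (trace_poly w) (i, j, length ps)\<bar>
    = real_of_int (int (coeff (\<Prod>k\<leftarrow>map (snd \<circ> fst) ps. abs_cheb k) i * coeff (\<Prod>k\<leftarrow>map (snd \<circ> snd) ps. abs_cheb k) j))"
    by (simp only: norm_of_int of_int_abs of_int_of_nat_eq of_nat_mult of_int_mult)
  then show ?thesis by (simp only: of_int_eq_iff)
qed

section \<open>Decomposing reduced words into syllables\<close>

lemma freely_reduced_append:
  "freely_reduced (u @ v) \<longleftrightarrow> freely_reduced u \<and> freely_reduced v \<and>
    (u = [] \<or> v = [] \<or> hd v \<noteq> inv_letter (last u))"
  unfolding freely_reduced_def successively_append_iff by auto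

lemma freely_reduced_Cons:
  "freely_reduced (s # w) \<longleftrightarrow> (w = [] \<or> hd w \<noteq> inv_letter s) \<and> freely_reduced w"
  using freely_reduced_append[of "[s]" w] by (auto simp: freely_reduced_def)

text \<open>Rotation creates one new junction, from the last letter of the word to its first, where
  cyclic reducedness forbids cancellation.\<close>

lemma freely_reduced_rotate:
  assumes "cyclically_reduced (u @ v)"
  shows "freely_reduced (v @ u)"
proof (cases "u = [] \<or> v = []")
  case False
  then have "last v \<noteq> inv_letter (hd u)"
    using assms by (simp add: cyclically_reduced_def)
  then have "hd u \<noteq> inv_letter (last v)"
    by (cases "hd u"; cases "last v") auto
  then show ?thesis using assms by (simp add: cyclically_reduced_def freely_reduced_append)
qed (use assms in \<open>auto simp: cyclically_reduced_def\<close>)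

text \<open>While the last letter is inverse to the first, strip both and collect the first letters
  in u.\<close>

lemma cyclic_reduction:
  assumes "freely_reduced w"
  shows "\<exists>u v. w = u @ v @ inv_word u \<and> cyclically_reduced v"
  using assms
proof (induction w rule: length_induct)
  case (1 w)
  show ?case
  proof (cases "cyclically_reduced w")
    case True
    then show ?thesis by (intro exI[of _ "[]"] exI[of _ w]) (simp add: inv_word_def)
  next
    case False
    with 1 have "w \<noteq> []" and l: "last w = inv_letter (hd w)" by (auto simp: cyclically_reduced_def)
    then obtain s w' where w: "w = s # w'" by (cases w) auto
    have "s \<noteq> inv_letter s" by (cases s) auto
    with l w have "w' \<noteq> []" by auto
    with l w have w': "w = s # butlast w' @ [inv_letter s]"
      using append_butlast_last_id[of w'] by simp
    with 1(2) have "freely_reduced (butlast w')" by (simp add: freely_reduced_Cons freely_reduced_append)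
    moreover have "length (butlast w') < length w" using w by simp
    ultimately obtain u v where "butlast w' = u @ v @ inv_word u" "cyclically_reduced v"
      using 1(1) by blast
    then show ?thesis
      by (intro exI[of _ "s # u"] exI[of _ v]) (use w' in \<open>simp add: inv_word_def\<close>)
  qed
qed

text \<open>The word is built by prepending letters, so the invariant must admit an unfinished
  leading run of b or its inverse. A letter prepended to a run of the same generator has the same
  sign, because the word is reduced, and extends the run; a letter of type a before a b-run opens a
  new pair.\<close>

lemma syllable_decomposition_aux:
  assumes "freely_reduced u" "u \<noteq> []" "last u \<in> {Pos_b, Neg_b}"
  shows "\<exists>ps l. set ps \<subseteq> syllable_pairs \<and>
    (if hd u \<in> {Pos_b, Neg_b} then u = replicate (Suc l) (hd u) @ concat (map syllable_word ps)
     else ps \<noteq> [] \<and> u = concat (map syllable_word ps))"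
  using assms
proof (induction u)
  case (Cons s u)
  show ?case
  proof (cases "u = []")
    case True
    then show ?thesis using Cons.prems by (intro exI[of _ "[]"] exI[of _ 0]) simp
  next
    case False
    with Cons obtain ps l where ps: "set ps \<subseteq> syllable_pairs" and u: "if hd u \<in> {Pos_b, Neg_b} then u = replicate (Suc l) (hd u) @ concat (map syllable_word ps)
     else ps \<noteq> [] \<and> u = concat (map syllable_word ps)"
      by (auto simp: freely_reduced_Cons)
    have red: "hd u \<noteq> inv_letter s" using Cons.prems False by (simp add: freely_reduced_Cons)
    show ?thesis
    proof (cases "s \<in> {Pos_b, Neg_b}")
      case sb: True
      show ?thesis
      proof (cases "hd u \<in> {Pos_b, Neg_b}")
        case True
        then have "hd u = s" using sb red by (cases s; cases "hd u") auto
        with True u have "s # u = replicate (Suc (Suc l)) s @ concat (map syllable_word ps)" by auto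
        with sb ps show ?thesis by (intro exI[of _ ps] exI[of _ "Suc l"]) simp
      next
        case False
        with u have "s # u = replicate (Suc 0) s @ concat (map syllable_word ps)" by auto
        with sb ps show ?thesis by (intro exI[of _ ps] exI[of _ 0]) simp
      qed
    next
      case sa: False
      then have sa': "s \<in> {Pos_a, Neg_a}" by (cases s) auto
      show ?thesis
      proof (cases "hd u \<in> {Pos_b, Neg_b}")
        case True
        let ?p = "((s, 1), (hd u, Suc l))"
        have "?p \<in> syllable_pairs" using sa' True by (auto simp: syllable_pairs_def)
        moreover have "s # u = concat (map syllable_word (?p # ps))"
          using True u by (auto simp: syllable_word_def)
        ultimately show ?thesis using ps unfolding list.sel(1) if_not_P[OF sa]
          by (intro exI[of _ "?p # ps"] exI[of _ 0] conjI) (simp, blast, assumption)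
      next
        case False
        with u obtain p qs where pq: "ps = p # qs" by (cases ps) auto
        obtain s' k r m where p: "p = ((s', k), (r, m))" by (metis surj_pair)
        have k: "k \<ge> 1" using ps by (auto simp: pq p syllable_pairs_def)
        have u': "u = replicate k s' @ replicate m r @ concat (map syllable_word qs)"
          using u False by (auto simp: pq p syllable_word_def)
        then have "hd u = s'" using k by (cases k) auto
        then have s': "s' = s" using sa' red False by (cases s; cases "hd u") auto
        let ?p = "((s, Suc k), (r, m))"
        have "?p \<in> syllable_pairs" using ps s' by (auto simp: pq p syllable_pairs_def)
        moreover have "s # u = concat (map syllable_word (?p # qs))"
          using u' s' by (auto simp: syllable_word_def)
        ultimately show ?thesis using ps unfolding list.sel(1) if_not_P[OF sa] pq
          by (intro exI[of _ "?p # qs"] exI[of _ 0] conjI) (simp, blast, assumption)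
      qed
    qed
  qed
qed simp

lemma syllable_decomposition:
  assumes "freely_reduced u" "u \<noteq> []" "hd u \<in> {Pos_a, Neg_a}" "last u \<in> {Pos_b, Neg_b}"
  shows "\<exists>ps. ps \<noteq> [] \<and> set ps \<subseteq> syllable_pairs \<and> u = concat (map syllable_word ps)"
  using syllable_decomposition_aux[OF assms(1,2,4)] assms(3) by auto

section \<open>Blocks that force syllables with exponent 3\<close>

definition cube_pair :: syllable_pair where
  "cube_pair = ((Pos_a, 3), (Pos_b, 3))"

text \<open>The outer b and a delimit the two cubes, so that both exponents are exactly 3 in any
  reduced word containing the pattern.\<close>

definition cube_pattern :: word where
  "cube_pattern = Pos_b # syllable_word cube_pair @ [Pos_a]"

lemma cube_pattern_eq: "cube_pattern = [Pos_b, Pos_a, Pos_a, Pos_a, Pos_b, Pos_b, Pos_b, Pos_a]"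
  by (simp add: cube_pattern_def cube_pair_def syllable_word_def numeral_3_eq_3)

text \<open>The first letter of a block is left free, because \<open>b\<close> cannot follow \<open>b\<^sup>-\<^sup>1\<close>.\<close>

fun good_blocks :: "word \<Rightarrow> nat" where
  "good_blocks w = (if length w < 9 then 0
     else of_bool (tl (take 9 w) = cube_pattern) + good_blocks (drop 9 w))"

declare good_blocks.simps [simp del]

lemma good_blocks_short [simp]: "length w < 9 \<Longrightarrow> good_blocks w = 0"
  by (simp add: good_blocks.simps)

lemma good_blocks_long: "length u = 9 \<Longrightarrow> good_blocks (u @ w) = of_bool (tl u = cube_pattern) + good_blocks w"
  by (simp add: good_blocks.simps[of "u @ w"])

lemma good_blocks_le: "9 * good_blocks w \<le> length w"
proof (induction w rule: good_blocks.induct)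
  case (1 w)
  then show ?case by (cases "length w < 9") (auto simp: good_blocks.simps[of w])
qed

text \<open>The cut is at a multiple of 9, so the remaining blocks keep their alignment and only the
  j removed ones can be lost.\<close>

lemma good_blocks_drop: "good_blocks w \<le> j + good_blocks (drop (9 * j) w)"
proof (induction j)
  case (Suc j)
  have "good_blocks v \<le> Suc (good_blocks (drop 9 v))" for v
    by (subst good_blocks.simps) simp
  from this[of "drop (9 * j) w"] Suc show ?case by (simp add: add.commute)
qed simp

lemma good_blocks_append: "good_blocks (u @ v) \<le> good_blocks u + length v"
proof (induction u rule: good_blocks.induct)
  case (1 u)
  show ?case
  proof (cases "length u < 9")
    case True
    then show ?thesis using good_blocks_le[of "u @ v"] by simp
  next
    case False
    have "u @ v = take 9 u @ (drop 9 u @ v)" by simp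
    moreover have "good_blocks (take 9 u @ (drop 9 u @ v)) = of_bool (tl (take 9 u) = cube_pattern) + good_blocks (drop 9 u @ v)"
      using False by (intro good_blocks_long) simp
    ultimately have "good_blocks (u @ v) = of_bool (tl (take 9 u) = cube_pattern) + good_blocks (drop 9 u @ v)"
      by (simp only:)
    then show ?thesis using 1 False by (simp add: good_blocks.simps[of u])
  qed
qed

text \<open>Between the a that closes one pattern and the b that opens the next stretch lies a
  reduced word starting with a and ending with b. It splits into syllable pairs, so the stretches
  can be glued. The flanking b and a in the conclusion are kept for this gluing.\<close>

lemma good_blocks_syllables:
  assumes "freely_reduced w" "good_blocks w > 0"
  shows "\<exists>pre qs post. w = pre @ [Pos_b] @ concat (map syllable_word qs) @ [Pos_a] @ post \<and>
    set qs \<subseteq> syllable_pairs \<and> good_blocks w \<le> count_list qs cube_pair"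
  using assms
proof (induction w rule: good_blocks.induct)
  case (1 w)
  have cp: "cube_pair \<in> syllable_pairs" by (auto simp: cube_pair_def syllable_pairs_def)
  have len: "\<not> length w < 9" using 1(3) by auto
  define u v where "u = take 9 w" and "v = drop 9 w"
  have w: "w = u @ v" by (simp add: u_def v_def)
  have gb: "good_blocks w = of_bool (tl u = cube_pattern) + good_blocks v"
    using len by (simp add: good_blocks.simps[of w] u_def v_def)
  have v: "freely_reduced v" using 1(2) by (simp add: w freely_reduced_append)
  have IH: "\<exists>pre qs post. v = pre @ [Pos_b] @ concat (map syllable_word qs) @ [Pos_a] @ post \<and>
    set qs \<subseteq> syllable_pairs \<and> good_blocks v \<le> count_list qs cube_pair" if "good_blocks v > 0"
    using 1(1)[OF len] v that by (simp add: v_def)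
  show ?case
  proof (cases "tl u = cube_pattern")
    case False
    then have "good_blocks v > 0" using 1(3) gb by simp
    then obtain pre qs post where "v = pre @ [Pos_b] @ concat (map syllable_word qs) @ [Pos_a] @ post"
      "set qs \<subseteq> syllable_pairs" "good_blocks v \<le> count_list qs cube_pair" using IH by blast
    then show ?thesis using False gb
      by (intro exI[of _ "u @ pre"] exI[of _ qs] exI[of _ post]) (simp add: w)
  next
    case True
    have "u \<noteq> []" using len by (auto simp: u_def)
    then have u: "u = [hd u] @ [Pos_b] @ syllable_word cube_pair @ [Pos_a]"
      using True by (cases u) (auto simp: cube_pattern_def)
    show ?thesis
    proof (cases "good_blocks v = 0")
      case True
      then show ?thesis using u gb cp \<open>tl u = cube_pattern\<close>
        by (intro exI[of _ "[hd u]"] exI[of _ "[cube_pair]"] exI[of _ v]) (simp add: w)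
    next
      case False
      then obtain pre qs post where v': "v = pre @ [Pos_b] @ concat (map syllable_word qs) @ [Pos_a] @ post"
        and qs: "set qs \<subseteq> syllable_pairs" "good_blocks v \<le> count_list qs cube_pair" using IH by blast
      have "w = ([hd u] @ [Pos_b] @ syllable_word cube_pair) @ ([Pos_a] @ pre @ [Pos_b]) @ (concat (map syllable_word qs) @ [Pos_a] @ post)"
        using u by (simp add: w v')
      then have "freely_reduced ([Pos_a] @ pre @ [Pos_b])"
        using 1(2) freely_reduced_append by blast
      from syllable_decomposition[OF this] obtain rs where rs: "set rs \<subseteq> syllable_pairs"
        "[Pos_a] @ pre @ [Pos_b] = concat (map syllable_word rs)" by auto
      have "w = [hd u] @ [Pos_b] @ concat (map syllable_word (cube_pair # rs @ qs)) @ [Pos_a] @ post"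
        using u rs(2)[symmetric] by (simp add: w v')
      moreover have "good_blocks w \<le> count_list (cube_pair # rs @ qs) cube_pair"
        using gb qs(2) by (simp add: count_list_append)
      ultimately show ?thesis using cp rs(1) qs(1)
        by (intro exI[of _ "[hd u]"] exI[of _ "cube_pair # rs @ qs"] exI[of _ post]) simp
    qed
  qed
qed

text \<open>Since w does not cancel over 9j letters, its cyclic reduction removes fewer than 9j
  letters at each end, and the middle part survives inside the cyclically reduced core. Rotating the
  core to start at the syllables found there leaves a remainder from a to b, which also splits into
  syllable pairs.\<close>

lemma cyclic_syllables:
  assumes w: "freely_reduced w" and j: "18 * j \<le> length w"
    and nc: "drop (length w - 9 * j) w \<noteq> inv_word (take (9 * j) w)"
    and gb: "good_blocks w > 10 * j"
  shows "\<exists>ps. ps \<noteq> [] \<and> set ps \<subseteq> syllable_pairs \<and>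
    (\<forall>A B. det A = 1 \<longrightarrow> det B = 1 \<longrightarrow>
       trace (word_image A B w) = trace (word_image A B (concat (map syllable_word ps)))) \<and>
    length (concat (map syllable_word ps)) \<le> length w \<and>
    good_blocks w \<le> 10 * j + count_list ps cube_pair"
proof -
  obtain u v where uv: "w = u @ v @ inv_word u" and v: "cyclically_reduced v"
    using cyclic_reduction[OF w] by blast
  have lu: "length (inv_word u) = length u" by (simp add: inv_word_def)
  have "length u < 9 * j"
  proof (rule ccontr)
    assume "\<not> length u < 9 * j"
    then have le: "9 * j \<le> length u" by simp
    have "drop (length w - 9 * j) w = drop (length u - 9 * j) (inv_word u)"
      using le by (simp add: uv lu)
    also have "\<dots> = inv_word (take (9 * j) u)"
      by (simp add: inv_word_def take_map rev_take rev_map drop_map)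
    also have "take (9 * j) u = take (9 * j) w" using le by (simp add: uv)
    finally show False using nc by contradiction
  qed
  define mid where "mid = drop (9 * j) (take (length w - 9 * j) w)"
  obtain l r where lr: "v = l @ mid @ r"
  proof
    let ?L = "length u"
    have v_eq: "v = drop ?L (take (length w - ?L) w)" by (simp add: uv lu)
    have "mid = drop (9 * j - ?L) (take (length w - 9 * j - ?L) v)"
      using \<open>length u < 9 * j\<close> j unfolding mid_def v_eq by (simp add: take_drop min_def)
    moreover have "take (9 * j - ?L) v = take (9 * j - ?L) (take (length w - 9 * j - ?L) v)"
      using j by (simp add: min_def)
    ultimately have "take (9 * j - ?L) v @ mid = take (length w - 9 * j - ?L) v"
      by (simp only: append_take_drop_id)
    then have "(take (9 * j - ?L) v @ mid) @ drop (length w - 9 * j - ?L) v = v"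
      by (simp only: append_take_drop_id)
    then show "v = take (9 * j - ?L) v @ mid @ drop (length w - 9 * j - ?L) v" by simp
  qed
  \<comment> \<open>The loss is at most 10j: j aligned blocks at the front, and at the back the
    crude bound of one block per letter.\<close>
  have "good_blocks w \<le> good_blocks (take (length w - 9 * j) w) + length (drop (length w - 9 * j) w)"
    using good_blocks_append[of "take (length w - 9 * j) w" "drop (length w - 9 * j) w"] by simp
  also have "\<dots> \<le> (j + good_blocks mid) + 9 * j"
    using good_blocks_drop[of "take (length w - 9 * j) w" j] j by (simp add: mid_def)
  finally have gm: "good_blocks w \<le> 10 * j + good_blocks mid" by simp
  moreover have "freely_reduced mid"
    using v by (simp add: lr cyclically_reduced_def freely_reduced_append)
  ultimately obtain pre qs post where m: "mid = pre @ [Pos_b] @ concat (map syllable_word qs) @ [Pos_a] @ post"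
    and qs: "set qs \<subseteq> syllable_pairs" "good_blocks mid \<le> count_list qs cube_pair"
    using good_blocks_syllables[of mid] gb by auto
  \<comment> \<open>The rest of the cyclic word, read from the a after the syllables
    \<open>qs\<close> around to the b before them.\<close>
  define t where "t = [Pos_a] @ (post @ r @ l @ pre) @ [Pos_b]"
  have v_eq: "v = (l @ pre @ [Pos_b]) @ (concat (map syllable_word qs) @ [Pos_a] @ post @ r)"
    by (simp add: lr m)
  from freely_reduced_rotate[OF v[unfolded v_eq]] have "freely_reduced (concat (map syllable_word qs) @ t)"
    by (simp add: t_def)
  then have "freely_reduced t" using freely_reduced_append by blast
  then obtain rs where rs: "rs \<noteq> []" "set rs \<subseteq> syllable_pairs" "t = concat (map syllable_word rs)"
    using syllable_decomposition[of t] by (auto simp: t_def)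
  have rot: "(concat (map syllable_word qs) @ [Pos_a] @ post @ r) @ (l @ pre @ [Pos_b]) = concat (map syllable_word (qs @ rs))"
    using rs(3)[symmetric] by (simp add: t_def)
  have "trace (word_image A B w) = trace (word_image A B (concat (map syllable_word (qs @ rs))))"
    if "det A = 1" "det B = 1" for A B
    unfolding uv trace_word_image_conj[OF that] rot[symmetric] v_eq by (rule trace_word_image_rotate)
  moreover have "length (concat (map syllable_word (qs @ rs))) \<le> length w"
    unfolding rot[symmetric] by (simp add: uv v_eq)
  ultimately show ?thesis using rs qs gm
    by (intro exI[of _ "qs @ rs"]) (auto simp: count_list_append)
qed

section \<open>Markov chains of letters\<close>

text \<open>The state is the previous letter, or \<open>None\<close> at the start, so both random
  models are instances.\<close>

primrec chain :: "(letter option \<Rightarrow> letter pmf) \<Rightarrow> nat \<Rightarrow> letter option \<Rightarrow> word pmf" where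
  "chain K 0 s = return_pmf []"
| "chain K (Suc n) s = bind_pmf (K s) (\<lambda>t. map_pmf (\<lambda>v. t # v) (chain K n (Some t)))"

lemma pmf_chain_Cons: "pmf (chain K (Suc n) s) (t # v) = pmf (K s) t * pmf (chain K n (Some t)) v"
proof -
  have *: "pmf (map_pmf (\<lambda>v. x # v) (chain K n (Some x))) (t # v) = (if x = t then pmf (chain K n (Some t)) v else 0)" for x
  proof (cases "x = t")
    case True
    then show ?thesis using pmf_map_inj'[of "\<lambda>v. t # v" "chain K n (Some t)" v] by (simp add: inj_def)
  next
    case False
    then have "t # v \<notin> set_pmf (map_pmf (\<lambda>v. x # v) (chain K n (Some x)))" by auto
    then show ?thesis using False by (simp add: pmf_eq_0_set_pmf)
  qed
  show ?thesis
    unfolding chain.simps pmf_bind *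
    by (subst integral_measure_pmf_real[where A = "{t}"]) (auto split: if_splits)
qed

lemma length_chain: "w \<in> set_pmf (chain K n s) \<Longrightarrow> length w = n"
  by (induction n arbitrary: w s) auto

lemma chain_add:
  "chain K (m + n) s = bind_pmf (chain K m s)
     (\<lambda>u. map_pmf (\<lambda>v. u @ v) (chain K n (if u = [] then s else Some (last u))))"
proof (induction m arbitrary: s)
  case 0
  have "(@) [] = (id :: word \<Rightarrow> word)" by (simp add: fun_eq_iff)
  then show ?case by (simp add: bind_return_pmf pmf.map_id)
next
  case (Suc m)
  show ?case
    unfolding add_Suc chain.simps Suc bind_assoc_pmf bind_map_pmf map_bind_pmf map_pmf_comp
    by (intro bind_pmf_cong refl) (auto intro!: map_pmf_cong)
qed

definition cancelling :: "nat \<Rightarrow> word \<Rightarrow> bool" where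
  "cancelling k w \<longleftrightarrow> drop (length w - k) w = inv_word (take k w)"

text \<open>The bound \<gamma> makes every individual word unlikely, which controls cancellation;
  \<delta> bounds the positive transitions from below, so that patterns occur. The assumption
  \<open>start\<close> supplies a letter c that can follow any state and be followed by b, which is
  the free first letter of a block.\<close>

locale letter_chain =
  fixes K :: "letter option \<Rightarrow> letter pmf" and \<gamma> \<delta> :: real
  assumes reduced: "x \<in> set_pmf (K s) \<Longrightarrow> pmf (K (Some x)) (inv_letter x) = 0"
    and le_\<gamma>: "pmf (K s) t \<le> \<gamma>" and \<gamma>: "0 < \<gamma>" "\<gamma> < 1"
    and \<delta>: "0 < \<delta>"
    and ge_\<delta>: "x \<in> {Pos_a, Pos_b} \<Longrightarrow> t \<in> {Pos_a, Pos_b} \<Longrightarrow> \<delta> \<le> pmf (K (Some x)) t"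
    and start: "\<exists>c. \<delta> \<le> pmf (K s) c \<and> \<delta> \<le> pmf (K (Some c)) Pos_b"
begin

lemma chain_reduced_Some:
  "w \<in> set_pmf (chain K n (Some s)) \<Longrightarrow> pmf (K (Some s)) (inv_letter s) = 0 \<Longrightarrow> freely_reduced (s # w)"
proof (induction n arbitrary: w s)
  case (Suc n)
  then obtain t v where w: "w = t # v" "t \<in> set_pmf (K (Some s))" "v \<in> set_pmf (chain K n (Some t))" by auto
  then have "t \<noteq> inv_letter s" using Suc.prems(2) by (auto simp: pmf_eq_0_set_pmf)
  then show ?case using Suc.IH[OF w(3) reduced[OF w(2)]] by (simp add: w(1) freely_reduced_Cons)
qed (simp add: freely_reduced_def)

lemma chain_reduced: "w \<in> set_pmf (chain K n s) \<Longrightarrow> freely_reduced w"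
  by (cases n) (auto simp: freely_reduced_def dest!: chain_reduced_Some[unfolded freely_reduced_def] reduced)

lemma pmf_chain_le: "pmf (chain K n s) v \<le> \<gamma> ^ n"
proof (induction n arbitrary: s v)
  case (Suc n)
  show ?case
  proof (cases v)
    case Nil
    then have "v \<notin> set_pmf (chain K (Suc n) s)" by auto
    then have "pmf (chain K (Suc n) s) v = 0" by (simp only: pmf_eq_0_set_pmf not_False_eq_True)
    then show ?thesis using \<gamma> by (simp del: chain.simps)
  next
    case (Cons t u)
    have "pmf (K s) t * pmf (chain K n (Some t)) u \<le> \<gamma> * \<gamma> ^ n"
      using \<gamma> by (intro mult_mono Suc le_\<gamma>) auto
    then show ?thesis unfolding Cons pmf_chain_Cons by simp
  qed
qed simp

text \<open>Condition on the first n - k letters. As 2k <= n they contain the first k, so the last k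
  letters are forced to be one specific word, of probability at most
  \<open>\<gamma> ^ k\<close>.\<close>

lemma prob_cancelling:
  assumes "2 * k \<le> n"
  shows "measure_pmf.prob (chain K n s) {w. cancelling k w} \<le> \<gamma> ^ k"
proof -
  let ?N = "\<lambda>u. chain K k (if u = [] then s else Some (last u))"
  have n: "n = (n - k) + k" using assms by simp
  have "emeasure (measure_pmf (chain K n s)) {w. cancelling k w}
    = (\<integral>\<^sup>+u. emeasure (measure_pmf (?N u)) {v. cancelling k (u @ v)} \<partial>chain K (n - k) s)"
    by (subst n, subst chain_add) (simp add: emeasure_bind_pmf vimage_def)
  also have "\<dots> \<le> (\<integral>\<^sup>+u. ennreal (\<gamma> ^ k) \<partial>chain K (n - k) s)"
  proof (intro nn_integral_mono_AE AE_pmfI)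
    fix u assume "u \<in> set_pmf (chain K (n - k) s)"
    then have u: "length u = n - k" by (rule length_chain)
    have "emeasure (measure_pmf (?N u)) {v. cancelling k (u @ v)} \<le> emeasure (measure_pmf (?N u)) {inv_word (take k u)}"
      using u assms by (intro emeasure_mono_AE AE_pmfI) (auto dest: length_chain simp: cancelling_def)
    also have "\<dots> \<le> ennreal (\<gamma> ^ k)"
      unfolding emeasure_pmf_single by (intro ennreal_leI pmf_chain_le)
    finally show "emeasure (measure_pmf (?N u)) {v. cancelling k (u @ v)} \<le> ennreal (\<gamma> ^ k)" .
  qed
  also have "\<dots> = ennreal (\<gamma> ^ k)" by simp
  finally show ?thesis using \<gamma> by (simp add: measure_pmf.emeasure_eq_measure)
qed

lemma pmf_chain_ge:
  assumes "set v \<subseteq> {Pos_a, Pos_b}" "s \<in> {Pos_a, Pos_b}"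
  shows "\<delta> ^ length v \<le> pmf (chain K (length v) (Some s)) v"
  using assms
proof (induction v arbitrary: s)
  case (Cons t v)
  have "\<delta> * \<delta> ^ length v \<le> pmf (K (Some s)) t * pmf (chain K (length v) (Some t)) v"
    using Cons.prems \<delta> by (intro mult_mono Cons.IH ge_\<delta>) auto
  then show ?case unfolding length_Cons pmf_chain_Cons by simp
qed simp

text \<open>The nine factors \<delta> come from the free letter c, the b after it and the seven
  remaining letters of the pattern.\<close>

lemma prob_cube_pattern: "\<delta> ^ 9 \<le> measure_pmf.prob (chain K 9 s) {u. tl u = cube_pattern}"
proof -
  obtain c where c: "\<delta> \<le> pmf (K s) c" "\<delta> \<le> pmf (K (Some c)) Pos_b" using start by blast
  define v where "v = tl cube_pattern"
  have v: "cube_pattern = Pos_b # v" "length v = 7" "set v \<subseteq> {Pos_a, Pos_b}"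
    by (auto simp: v_def cube_pattern_eq)
  have "\<delta> * (\<delta> * \<delta> ^ length v) \<le> pmf (K s) c * (pmf (K (Some c)) Pos_b * pmf (chain K (length v) (Some Pos_b)) v)"
    using \<delta> v by (intro mult_mono c pmf_chain_ge) auto
  also have "\<dots> = pmf (chain K 9 s) (c # Pos_b # v)"
    using v(2) by (simp add: pmf_chain_Cons numeral_eq_Suc del: chain.simps)
  also have "\<dots> = measure_pmf.prob (chain K 9 s) {c # Pos_b # v}" by (simp add: measure_pmf_single)
  also have "\<dots> \<le> measure_pmf.prob (chain K 9 s) {u. tl u = cube_pattern}"
    by (intro measure_pmf.finite_measure_mono) (auto simp: v)
  finally show ?thesis by (simp add: v(2) numeral_eq_Suc)
qed

text \<open>An upper bound for the mean factor that one block contributes to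
  \<open>(1/2) ^ good_blocks w\<close>: the factor is 1/2 with probability at least
  \<open>\<delta> ^ 9\<close>, and otherwise 1.\<close>

definition \<rho> :: real where "\<rho> = 1 - \<delta> ^ 9 / 2"

lemma \<rho>: "0 < \<rho>" "\<rho> < 1"
proof -
  have "\<delta> ^ 9 \<le> 1" using prob_cube_pattern[of None] measure_pmf.prob_le_1 order.trans by blast
  then show "0 < \<rho>" "\<rho> < 1" using \<delta> by (auto simp: \<rho>_def)
qed

text \<open>An exponential moment bound: from any state, the next nine letters form a good block with
  probability at least \<open>\<delta>\<^sup>9\<close>.\<close>

lemma half_power_good_blocks:
  "(\<integral>\<^sup>+w. ennreal ((1/2) ^ good_blocks w) \<partial>chain K (9 * m + r) s) \<le> ennreal (\<rho> ^ m)"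
proof (induction m arbitrary: s)
  case 0
  have "(\<integral>\<^sup>+w. ennreal ((1/2) ^ good_blocks w) \<partial>chain K r s) \<le> (\<integral>\<^sup>+w. 1 \<partial>chain K r s)"
    by (intro nn_integral_mono) (simp add: power_le_one)
  then show ?case by simp
next
  case (Suc m)
  let ?N = "\<lambda>u. chain K (9 * m + r) (if u = [] then s else Some (last u))"
  let ?S = "{u. tl u = cube_pattern}"
  have n: "9 * Suc m + r = 9 + (9 * m + r)" by simp
  have "(\<integral>\<^sup>+w. ennreal ((1/2) ^ good_blocks w) \<partial>chain K (9 * Suc m + r) s)
    = (\<integral>\<^sup>+u. (\<integral>\<^sup>+v. ennreal ((1/2) ^ good_blocks (u @ v)) \<partial>?N u) \<partial>chain K 9 s)"
    unfolding n chain_add[of K 9] by (simp add: nn_integral_bind_pmf)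
  also have "\<dots> \<le> (\<integral>\<^sup>+u. ennreal (1 - indicator ?S u / 2) * ennreal (\<rho> ^ m) \<partial>chain K 9 s)"
  proof (intro nn_integral_mono_AE AE_pmfI)
    fix u assume "u \<in> set_pmf (chain K 9 s)"
    then have u: "length u = 9" by (rule length_chain)
    have "(1/2::real) ^ good_blocks (u @ v) = (1 - indicator ?S u / 2) * (1/2) ^ good_blocks v" for v
      by (simp add: good_blocks_long[OF u] indicator_def)
    then have "(\<integral>\<^sup>+v. ennreal ((1/2) ^ good_blocks (u @ v)) \<partial>?N u)
      = ennreal (1 - indicator ?S u / 2) * (\<integral>\<^sup>+v. ennreal ((1/2) ^ good_blocks v) \<partial>?N u)"
      by (simp add: ennreal_mult nn_integral_cmult indicator_def del: ennreal_half)
    also have "\<dots> \<le> ennreal (1 - indicator ?S u / 2) * ennreal (\<rho> ^ m)"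
      by (intro mult_left_mono Suc) simp
    finally show "(\<integral>\<^sup>+v. ennreal ((1/2) ^ good_blocks (u @ v)) \<partial>?N u) \<le> \<dots>" .
  qed
  also have "\<dots> = (\<integral>\<^sup>+u. ennreal (1 - indicator ?S u / 2) \<partial>chain K 9 s) * ennreal (\<rho> ^ m)"
    by (simp add: nn_integral_multc)
  also have "(\<integral>\<^sup>+u. ennreal (1 - indicator ?S u / 2) \<partial>chain K 9 s)
    = ennreal (\<integral>u. 1 - indicator ?S u / 2 \<partial>chain K 9 s)"
    by (intro nn_integral_eq_integral measure_pmf.integrable_const_bound[where B = 1])
       (auto simp: indicator_def)
  also have "(\<integral>u. 1 - indicator ?S u / 2 \<partial>chain K 9 s) = 1 - measure_pmf.prob (chain K 9 s) ?S / 2"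
  proof -
    have "integrable (chain K 9 s) (\<lambda>u. indicator ?S u / 2 :: real)"
      by (intro measure_pmf.integrable_const_bound[where B = 1]) (auto simp: indicator_def)
    then show ?thesis by (subst Bochner_Integration.integral_diff) (simp_all add: measure_pmf.prob_space)
  qed
  also have "ennreal (1 - measure_pmf.prob (chain K 9 s) ?S / 2) * ennreal (\<rho> ^ m) \<le> ennreal \<rho> * ennreal (\<rho> ^ m)"
    using prob_cube_pattern[of s] by (intro mult_right_mono ennreal_leI) (auto simp: \<rho>_def)
  also have "\<dots> = ennreal (\<rho> ^ Suc m)" using \<rho> by (simp add: ennreal_mult)
  finally show ?case .
qed

text \<open>Markov's inequality for \<open>(1/2) ^ good_blocks w\<close>, which is at least
  \<open>(1/2) ^ k\<close> on the event.\<close>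

lemma prob_good_blocks_le:
  "measure_pmf.prob (chain K n s) {w. good_blocks w \<le> k} \<le> 2 ^ k * \<rho> ^ (n div 9)"
proof -
  have "emeasure (measure_pmf (chain K n s)) {w. good_blocks w \<le> k}
    = (\<integral>\<^sup>+w. indicator {w. good_blocks w \<le> k} w \<partial>chain K n s)" by simp
  also have "\<dots> \<le> (\<integral>\<^sup>+w. ennreal (2 ^ k) * ennreal ((1/2) ^ good_blocks w) \<partial>chain K n s)"
  proof (intro nn_integral_mono)
    fix w
    have "1 \<le> 2 ^ k * (1/2::real) ^ good_blocks w" if "good_blocks w \<le> k"
      using power_increasing[OF that, of "2::real"] by (simp add: power_divide field_simps)
    then show "indicator {w. good_blocks w \<le> k} w \<le> ennreal (2 ^ k) * ennreal ((1/2) ^ good_blocks w)"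
      by (auto simp: indicator_def simp flip: ennreal_mult intro!: ennreal_leI[of 1, simplified])
  qed
  also have "\<dots> = ennreal (2 ^ k) * (\<integral>\<^sup>+w. ennreal ((1/2) ^ good_blocks w) \<partial>chain K (9 * (n div 9) + n mod 9) s)"
    by (subst nn_integral_cmult) auto
  also have "\<dots> \<le> ennreal (2 ^ k) * ennreal (\<rho> ^ (n div 9))"
    by (intro mult_left_mono half_power_good_blocks) simp
  also have "\<dots> = ennreal (2 ^ k * \<rho> ^ (n div 9))" using \<rho> by (simp add: ennreal_mult)
  finally show ?thesis using \<rho> by (simp add: measure_pmf.emeasure_eq_measure)
qed

end

text \<open>The deterministic input to \<open>cyclic_syllables\<close>: after its loss of 10j, at
  least \<epsilon> n cube pairs remain.\<close>

definition good_words :: "real \<Rightarrow> nat \<Rightarrow> word set" where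
  "good_words \<epsilon> n = {w. length w = n \<and> freely_reduced w \<and>
     (\<exists>j. 18 * j \<le> n \<and> \<not> cancelling (9 * j) w \<and> \<epsilon> * real n + 10 * real j < real (good_blocks w))}"

definition exp_likely :: "(nat \<Rightarrow> word pmf) \<Rightarrow> (nat \<Rightarrow> word set) \<Rightarrow> bool" where
  "exp_likely W S \<longleftrightarrow> (\<exists>C>0. \<exists>\<mu>>0. \<forall>n\<ge>1. measure_pmf.prob (W n) (S n) \<ge> 1 - C * exp (- \<mu> * real n))"

lemma nat_floor_bounds:
  assumes "0 \<le> (x::real)"
  shows "real (nat \<lfloor>x\<rfloor>) \<le> x" "x < real (nat \<lfloor>x\<rfloor>) + 1"
proof -
  have "real (nat \<lfloor>x\<rfloor>) = of_int \<lfloor>x\<rfloor>" using assms by simp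
  then show "real (nat \<lfloor>x\<rfloor>) \<le> x" "x < real (nat \<lfloor>x\<rfloor>) + 1" by linarith+
qed

lemma (in letter_chain) exp_likely_good_words:
  "\<exists>\<epsilon>>0. exp_likely (\<lambda>n. chain K n s) (good_words \<epsilon>)"
proof -
  \<comment> \<open>With k about \<epsilon> n, the factor \<open>2 ^ k\<close> uses up at most half
    of the decay of \<open>\<rho> ^ (n div 9)\<close>. The bound \<epsilon> <= 1 ensures 18j <=
    n.\<close>
  define \<epsilon> where "\<epsilon> = min 1 (- ln \<rho> / (18 * ln 2))"
  have \<epsilon>: "0 < \<epsilon>" "\<epsilon> \<le> 1" "\<epsilon> * ln 2 \<le> - ln \<rho> / 18"
    using \<rho> by (auto simp: \<epsilon>_def min_def field_simps)
  define \<mu> where "\<mu> = min (- ln \<rho> / 18) (- 9 * \<epsilon> / 20 * ln \<gamma>)"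
  have \<mu>: "0 < \<mu>" using \<rho> \<gamma> \<epsilon> by (auto simp: \<mu>_def mult_pos_neg)
  \<comment> \<open>The two terms pay for rounding down n/9 and j, respectively.\<close>
  define C where "C = 1 / \<rho> + 1 / \<gamma> ^ 9"
  have C: "0 < C" using \<rho> \<gamma> by (auto simp: C_def intro!: add_pos_pos)
  have "1 - C * exp (- \<mu> * real n) \<le> measure_pmf.prob (chain K n s) (good_words (\<epsilon> / 2) n)" for n
  proof -
    let ?P = "measure_pmf.prob (chain K n s)"
    define k where "k = nat \<lfloor>\<epsilon> * real n\<rfloor>"
    \<comment> \<open>Then 10j is at most half of \<epsilon> n, and the other half is the margin
      \<epsilon>/2 of the good words.\<close>
    define j where "j = nat \<lfloor>\<epsilon> / 20 * real n\<rfloor>"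
    have k: "real k \<le> \<epsilon> * real n" "\<epsilon> * real n < real k + 1"
      using \<epsilon> nat_floor_bounds[of "\<epsilon> * real n"] by (simp_all add: k_def)
    have j: "real j \<le> \<epsilon> / 20 * real n" "\<epsilon> / 20 * real n < real j + 1"
      using \<epsilon> nat_floor_bounds[of "\<epsilon> / 20 * real n"] by (simp_all add: j_def)
    have "18 * real j \<le> \<epsilon> * real n" using j \<epsilon> by simp
    also have "\<dots> \<le> real n" using \<epsilon> by (simp add: mult_left_le_one_le)
    finally have j18: "18 * j \<le> n" by linarith
    have "?P {w. good_blocks w \<le> k} \<le> 2 ^ k * \<rho> ^ (n div 9)" by (rule prob_good_blocks_le)
    also have "\<dots> = exp (real k * ln 2 + real (n div 9) * ln \<rho>)"
      using \<rho> by (simp add: exp_add exp_of_nat_mult)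
    also have "\<dots> \<le> exp (- ln \<rho> - \<mu> * real n)"
    proof -
      have "real k * ln 2 \<le> real n * (\<epsilon> * ln 2)" using k by (simp add: mult_ac)
      also have "\<dots> \<le> real n * (- ln \<rho> / 18)" using \<epsilon> by (intro mult_left_mono) auto
      finally have 1: "real k * ln 2 \<le> real n * (- ln \<rho> / 18)" .
      have "real n / 9 - 1 \<le> real (n div 9)" by linarith
      then have 2: "real (n div 9) * ln \<rho> \<le> (real n / 9 - 1) * ln \<rho>"
        using \<rho> by (intro mult_right_mono_neg) auto
      have 3: "\<mu> * real n \<le> (- ln \<rho> / 18) * real n" by (intro mult_right_mono) (auto simp: \<mu>_def)
      show ?thesis using 1 2 3 by (simp add: algebra_simps)
    qed
    also have "\<dots> = 1 / \<rho> * exp (- \<mu> * real n)"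
      using \<rho> by (simp add: exp_diff exp_minus divide_inverse)
    finally have P1: "?P {w. good_blocks w \<le> k} \<le> 1 / \<rho> * exp (- \<mu> * real n)" .
    have "?P {w. cancelling (9 * j) w} \<le> \<gamma> ^ (9 * j)"
      using j18 by (intro prob_cancelling) simp
    also have "\<dots> = exp (real (9 * j) * ln \<gamma>)" using \<gamma> by (simp add: exp_of_nat_mult del: of_nat_mult)
    also have "\<dots> \<le> exp (- 9 * ln \<gamma> - \<mu> * real n)"
    proof -
      have "real (9 * j) * ln \<gamma> \<le> 9 * (\<epsilon> / 20 * real n - 1) * ln \<gamma>"
        using \<gamma> j by (intro mult_right_mono_neg) auto
      moreover have "\<mu> * real n \<le> (- 9 * \<epsilon> / 20 * ln \<gamma>) * real n"
        by (intro mult_right_mono) (auto simp: \<mu>_def)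
      ultimately show ?thesis by (simp add: algebra_simps)
    qed
    also have "\<dots> = 1 / \<gamma> ^ 9 * exp (- \<mu> * real n)"
    proof -
      have "exp (9 * ln \<gamma>) = \<gamma> ^ 9" using \<gamma> exp_of_nat_mult[of 9 "ln \<gamma>"] by simp
      then show ?thesis by (simp add: exp_diff exp_minus divide_inverse)
    qed
    finally have P2: "?P {w. cancelling (9 * j) w} \<le> 1 / \<gamma> ^ 9 * exp (- \<mu> * real n)" .
    have "?P (- good_words (\<epsilon> / 2) n) \<le> ?P ({w. good_blocks w \<le> k} \<union> {w. cancelling (9 * j) w})"
    proof (intro measure_pmf.finite_measure_mono_AE AE_pmfI impI)
      fix w assume w: "w \<in> set_pmf (chain K n s)" and bad: "w \<in> - good_words (\<epsilon> / 2) n"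
      have "\<epsilon> / 2 * real n + 10 * real j < real (good_blocks w)" if "\<not> good_blocks w \<le> k"
        using that k j by linarith
      then show "w \<in> {w. good_blocks w \<le> k} \<union> {w. cancelling (9 * j) w}"
        using bad j18 length_chain[OF w] chain_reduced[OF w] unfolding good_words_def by auto
    qed auto
    also have "\<dots> \<le> ?P {w. good_blocks w \<le> k} + ?P {w. cancelling (9 * j) w}"
      by (rule measure_Un_le) auto
    also have "\<dots> \<le> C * exp (- \<mu> * real n)" using P1 P2 by (simp add: C_def algebra_simps)
    finally show ?thesis
      using measure_pmf.prob_compl[of "good_words (\<epsilon> / 2) n" "chain K n s"] by (simp add: Compl_eq_Diff_UNIV)
  qed
  then show ?thesis using \<epsilon> \<mu> C unfolding exp_likely_def by (intro exI[of _ "\<epsilon> / 2"]) auto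
qed

section \<open>Output length and running time\<close>

text \<open>N bounds the nonblank cells per tape; a step rewrites one cell of each tape and so
  raises the bound by at most 1. The ranges of states and symbols are carried along so that
  \<open>wf_tm\<close> applies to the next step.\<close>

definition tm_invariant :: "tm \<Rightarrow> nat \<Rightarrow> config \<Rightarrow> bool" where
  "tm_invariant M N c \<longleftrightarrow> fst c < num_states M \<and> length (snd c) = num_tapes M \<and>
    (\<forall>tp\<in>set (snd c). (\<forall>i. fst tp i < num_symbols M) \<and> finite {i. fst tp i \<noteq> 0} \<and> card {i. fst tp i \<noteq> 0} \<le> N)"

lemma tm_invariant_init:
  assumes "wf_tm M"
  shows "tm_invariant M (length w) (tm_init M w)"
proof -
  have 1: "num_tapes M \<ge> 1" "num_symbols M \<ge> 7" "start_state M < num_states M"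
    using assms by (auto simp: wf_tm_def)
  have "letter_symbol s < 7" for s by (cases s) auto
  then have "input_tape w i < 7" for i by (simp add: input_tape_def)
  then have 2: "input_tape w i < num_symbols M" for i
    using 1(2) less_le_trans by blast
  have sub: "{i. input_tape w i \<noteq> 0} \<subseteq> {..<length w}"
    by (auto simp: input_tape_def split: if_splits)
  then have 3: "finite {i. input_tape w i \<noteq> 0}" "card {i. input_tape w i \<noteq> 0} \<le> length w"
    using finite_subset card_mono[OF _ sub] by auto
  show ?thesis
    using 1 2 3 unfolding tm_invariant_def tm_init_def by auto
qed

lemma tm_invariant_step:
  assumes M: "wf_tm M" and c: "tm_invariant M N c"
  shows "tm_invariant M (Suc N) (tm_step M c)"
proof -
  obtain q tps where c_eq: "c = (q, tps)" by (cases c)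
  show ?thesis
  proof (cases "q = halt_state M")
    case True
    then show ?thesis using c by (auto simp: tm_step_def c_eq tm_invariant_def intro: le_SucI)
  next
    case False
    let ?ss = "map (\<lambda>(t, h). t h) tps"
    obtain q' acts where d: "delta M q ?ss = (q', acts)" by (cases "delta M q ?ss")
    have ss: "length ?ss = num_tapes M" "set ?ss \<subseteq> {..<num_symbols M}"
      using c by (auto simp: c_eq tm_invariant_def)
    have "fst (delta M q ?ss) < num_states M \<and> length (snd (delta M q ?ss)) = num_tapes M \<and>
        fst ` set (snd (delta M q ?ss)) \<subseteq> {..<num_symbols M}"
      using M False c ss unfolding wf_tm_def by (auto simp: c_eq tm_invariant_def)
    then have q': "q' < num_states M" and len: "length acts = num_tapes M" and acts: "fst ` set acts \<subseteq> {..<num_symbols M}"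
      by (auto simp: d)
    let ?f = "\<lambda>(s, d) (t, h). (t(h := s), move_head d h)"
    have step: "tm_step M c = (q', map2 ?f acts tps)"
      using False by (simp add: tm_step_def c_eq d)
    have new: "(\<forall>i. fst tp i < num_symbols M) \<and> finite {i. fst tp i \<noteq> 0} \<and> card {i. fst tp i \<noteq> 0} \<le> Suc N"
      if tp: "tp \<in> set (map2 ?f acts tps)" for tp
    proof -
      obtain x where x: "x \<in> set (zip acts tps)" "tp = (case x of (p, r) \<Rightarrow> ?f p r)"
        using tp by auto
      obtain s e t h where x': "x = ((s, e), (t, h))" by (metis surj_pair)
      have *: "(s, e) \<in> set acts" "(t, h) \<in> set tps" "tp = (t(h := s), move_head e h)"
        using x unfolding x' by (auto dest: set_zip_leftD set_zip_rightD)
      have t: "\<forall>i. t i < num_symbols M" "finite {i. t i \<noteq> 0}" "card {i. t i \<noteq> 0} \<le> N"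
        using c *(2) by (auto simp: c_eq tm_invariant_def)
      have s: "s < num_symbols M" using *(1) acts by auto
      have sub: "{i. (t(h := s)) i \<noteq> 0} \<subseteq> insert h {i. t i \<noteq> 0}" by auto
      have "card {i. (t(h := s)) i \<noteq> 0} \<le> card (insert h {i. t i \<noteq> 0})"
        using t(2) by (intro card_mono sub) simp
      also have "\<dots> \<le> Suc N" using t(2,3) by (simp add: card_insert_if)
      finally show ?thesis
        using t s finite_subset[OF sub] *(3) by auto
    qed
    have "length (map2 ?f acts tps) = num_tapes M" using len ss(1) by simp
    then show ?thesis
      unfolding tm_invariant_def step fst_conv snd_conv using q' new by blast
  qed
qed

lemma tm_invariant_run: "wf_tm M \<Longrightarrow> tm_invariant M (length w + t) (tm_run M w t)"
  unfolding tm_run_def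
  by (induction t) (auto simp: tm_invariant_init dest: tm_invariant_step)

text \<open>A blank-free output occupies that many nonblank cells of the last tape; at most
  \<open>length w\<close> are present initially, and each step adds at most one.\<close>

lemma length_output_le:
  assumes "wf_tm M" "tm_outputs M w out" "0 \<notin> set out"
  shows "length out \<le> length w + running_time M w"
proof -
  let ?c = "tm_run M w (running_time M w)"
  let ?tape = "fst (last (snd ?c))"
  have inv: "tm_invariant M (length w + running_time M w) ?c" by (rule tm_invariant_run[OF assms(1)])
  then have "snd ?c \<noteq> []" using assms(1) by (auto simp: tm_invariant_def wf_tm_def)
  then have "last (snd ?c) \<in> set (snd ?c)" by simp
  then have tape: "finite {i. ?tape i \<noteq> 0}" "card {i. ?tape i \<noteq> 0} \<le> length w + running_time M w"
    using inv unfolding tm_invariant_def by auto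
  have "\<forall>i<length out. ?tape i = out ! i" using assms(2) by (simp add: tm_outputs_def Let_def)
  then have "?tape i \<noteq> 0" if "i < length out" for i
    using that assms(3) nth_mem[OF that] by (metis)
  then have "{..<length out} \<subseteq> {i. ?tape i \<noteq> 0}" by blast
  then have "card {..<length out} \<le> card {i. ?tape i \<noteq> 0}" using tape(1) by (rule card_mono[rotated])
  then show ?thesis using tape(2) by simp
qed

section \<open>Output length and running time against the bit norm\<close>

lemma bit_norm_le_length:
  assumes "sparse_binary_convention R" "R f out"
  shows "bit_norm f \<le> length out" "0 \<notin> set out"
proof -
  obtain ms before after header trailer where ms: "distinct ms" "set ms = Poly_Mapping.keys f"
    and out: "out = header @
             concat (map (\<lambda>m. before m @ binary_string (nat \<bar>Poly_Mapping.lookup f m\<bar>) @ after m) ms)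
             @ trailer"
    using assms unfolding sparse_binary_convention_def by blast
  \<comment> \<open>The list \<open>ms\<close> enumerates the support without repetition, and the
    string written for each m contains all binary digits of its coefficient.\<close>
  have "bit_norm f = (\<Sum>m\<leftarrow>ms. bit_length (Poly_Mapping.lookup f m))"
    using ms by (simp add: bit_norm_def sum_list_distinct_conv_sum_set)
  also have "\<dots> \<le> length (concat (map (\<lambda>m. before m @ binary_string (nat \<bar>Poly_Mapping.lookup f m\<bar>) @ after m) ms))"
    by (simp add: length_concat comp_def bit_length_def binary_string_def sum_list_mono)
  finally show "bit_norm f \<le> length out" by (simp add: out)
  show "0 \<notin> set out" using assms unfolding sparse_binary_convention_def by fastforce
qed

lemma bit_norm_le_running_time:
  assumes "sparse_binary_convention R" "computes_trace_poly_on M R S" "w \<in> S"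
  shows "bit_norm (trace_poly w) \<le> length w + running_time M w"
proof -
  obtain out where "R (trace_poly w) out" "tm_outputs M w out" "wf_tm M"
    using assms(2,3) unfolding computes_trace_poly_on_def by blast
  then show ?thesis
    using bit_norm_le_length[OF assms(1), of "trace_poly w" out] length_output_le[of M w out] by linarith
qed

lemma less_two_power_length_binary_expansion: "m < 2 ^ length (binary_expansion m)"
proof (induction m rule: binary_expansion.induct)
  case (1 m)
  show ?case
  proof (cases "m = 0")
    case False
    with 1 have "m div 2 < 2 ^ length (binary_expansion (m div 2))" by simp
    then show ?thesis using False by (subst binary_expansion.simps) simp
  qed simp
qed

lemma less_bit_length:
  assumes "2 ^ k \<le> \<bar>m\<bar>"
  shows "k < bit_length m"
proof -
  have "(2::nat) ^ k \<le> nat \<bar>m\<bar>" using assms by (simp add: le_nat_iff)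
  also have "\<dots> < 2 ^ bit_length m" unfolding bit_length_def by (rule less_two_power_length_binary_expansion)
  finally show ?thesis by simp
qed

section \<open>The random models\<close>

lemma UNIV_letter: "UNIV = {Pos_a, Neg_a, Pos_b, Neg_b}"
  using letter.exhaust by auto

lemma finite_UNIV_letter [simp]: "finite (UNIV :: letter set)"
  by (simp add: UNIV_letter)

definition positive_kernel :: "real \<Rightarrow> letter option \<Rightarrow> letter pmf" where
  "positive_kernel p s = map_pmf (\<lambda>h. if h then Pos_a else Pos_b) (bernoulli_pmf p)"

lemma positive_word_eq_chain: "positive_word p n = chain (positive_kernel p) n s"
  unfolding positive_word_def
  by (induction n arbitrary: s) (simp_all add: positive_kernel_def map_pmf_def)

lemma pmf_positive_kernel:
  assumes "0 < p" "p < 1"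
  shows "pmf (positive_kernel p s) t = (case t of Pos_a \<Rightarrow> p | Pos_b \<Rightarrow> 1 - p | _ \<Rightarrow> 0)"
proof -
  let ?f = "\<lambda>h. if h then Pos_a else Pos_b"
  have inj: "inj ?f" by (auto simp: inj_def)
  have "pmf (positive_kernel p s) Pos_a = p" "pmf (positive_kernel p s) Pos_b = 1 - p"
    using pmf_map_inj'[OF inj, of "bernoulli_pmf p" True] pmf_map_inj'[OF inj, of "bernoulli_pmf p" False] assms
    by (simp_all add: positive_kernel_def)
  moreover have "pmf (positive_kernel p s) Neg_a = 0" "pmf (positive_kernel p s) Neg_b = 0"
    by (auto simp: pmf_eq_0_set_pmf positive_kernel_def split: if_splits)
  ultimately show ?thesis by (cases t) auto
qed

lemma letter_chain_positive_kernel: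
  assumes "0 < p" "p < 1"
  shows "letter_chain (positive_kernel p) (max p (1 - p)) (min p (1 - p))"
proof
  show "\<exists>c. min p (1 - p) \<le> pmf (positive_kernel p s) c \<and> min p (1 - p) \<le> pmf (positive_kernel p (Some c)) Pos_b" for s
    by (intro exI[of _ Pos_a]) (simp add: pmf_positive_kernel[OF assms])
  fix x s assume "x \<in> set_pmf (positive_kernel p s)"
  then have "x \<in> {Pos_a, Pos_b}" by (auto simp: positive_kernel_def split: if_splits)
  then show "pmf (positive_kernel p (Some x)) (inv_letter x) = 0"
    by (auto simp: pmf_positive_kernel[OF assms])
qed (use assms in \<open>auto simp: pmf_positive_kernel split: letter.split\<close>)

definition reduced_kernel :: "letter option \<Rightarrow> letter pmf" where
  "reduced_kernel s = pmf_of_set (case s of None \<Rightarrow> UNIV | Some x \<Rightarrow> UNIV - {inv_letter x})"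

lemma UNIV_minus_letter: "UNIV - {x :: letter} \<noteq> {}" "card (UNIV - {x :: letter}) = 3" "card (UNIV :: letter set) = 4"
  by (cases x; auto simp: UNIV_letter)+

lemma pmf_reduced_kernel:
  "pmf (reduced_kernel None) t = 1 / 4"
  "pmf (reduced_kernel (Some x)) t = (if t = inv_letter x then 0 else 1 / 3)"
proof -
  show "pmf (reduced_kernel None) t = 1 / 4" by (simp add: reduced_kernel_def UNIV_minus_letter)
  have "finite (UNIV - {inv_letter x})" by simp
  from pmf_of_set[OF UNIV_minus_letter(1) this, of t]
  show "pmf (reduced_kernel (Some x)) t = (if t = inv_letter x then 0 else 1 / 3)"
    unfolding reduced_kernel_def option.case UNIV_minus_letter(2) by (simp only: indicator_def) simp
qed

lemma reduced_continuation_eq_chain: "reduced_continuation n s = chain reduced_kernel n (Some s)"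
  by (induction n arbitrary: s) (simp_all add: reduced_kernel_def)

lemma reduced_word_eq_chain: "reduced_word n = chain reduced_kernel n None"
  by (cases n) (simp_all add: reduced_continuation_eq_chain, simp add: reduced_kernel_def)

lemma letter_chain_reduced_kernel: "letter_chain reduced_kernel (1 / 3) (1 / 4)"
proof
  fix s
  show "\<exists>c. 1 / 4 \<le> pmf (reduced_kernel s) c \<and> 1 / 4 \<le> pmf (reduced_kernel (Some c)) Pos_b"
  proof (cases s)
    case None
    then show ?thesis by (intro exI[of _ Pos_a]) (simp add: pmf_reduced_kernel)
  next
    case (Some x)
    then show ?thesis
      \<comment> \<open>The letter c is a, except after the inverse of a, where a is forbidden and c
        repeats that inverse; in both cases b may follow.\<close>
      by (cases "x = Neg_a"; intro exI[of _ "if x = Neg_a then Neg_a else Pos_a"]; cases x)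
         (simp_all add: pmf_reduced_kernel)
  qed
  show "pmf (reduced_kernel s) t \<le> 1 / 3" for t
    by (cases s) (simp_all add: pmf_reduced_kernel)
qed (auto simp: pmf_reduced_kernel)

lemma pmf_chain_reduced_kernel_Some:
  "pmf (chain reduced_kernel n (Some s)) w = (if length w = n \<and> freely_reduced (s # w) then (1 / 3) ^ n else 0)"
proof (induction n arbitrary: s w)
  case 0
  then show ?case by (auto simp: pmf_return freely_reduced_def)
next
  case (Suc n)
  show ?case
  proof (cases w)
    case Nil
    then have "w \<notin> set_pmf (chain reduced_kernel (Suc n) (Some s))" by auto
    then have "pmf (chain reduced_kernel (Suc n) (Some s)) w = 0" by (simp only: pmf_eq_0_set_pmf not_False_eq_True)
    then show ?thesis using Nil by (simp del: chain.simps)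
  next
    case (Cons t v)
    then show ?thesis
      by (auto simp: pmf_chain_Cons Suc pmf_reduced_kernel freely_reduced_Cons simp del: chain.simps)
  qed
qed

section \<open>From reduced to cyclically reduced words\<close>

lemma pmf_reduced_word:
  assumes "n \<ge> 1" "length w = n" "freely_reduced w"
  shows "pmf (reduced_word n) w = 1 / 4 * (1 / 3) ^ (n - 1)"
proof -
  obtain t v where "w = t # v" using assms by (cases w) auto
  then show ?thesis using assms
    by (auto simp: reduced_word_eq_chain pmf_chain_Cons pmf_chain_reduced_kernel_Some pmf_reduced_kernel simp del: chain.simps)
qed

lemma finite_words: "finite {w :: word. length w = n \<and> Q w}"
  by (rule finite_subset[OF _ finite_lists_length_eq[OF finite_UNIV_letter, of n]]) auto

text \<open>For n >= 2 failure means cancellation of the outermost letters, of probability at most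
  1/3 by \<open>prob_cancelling\<close>. A single letter is never its own inverse, which settles n =
  1.\<close>

lemma prob_cyclically_reduced:
  assumes "n \<ge> 1"
  shows "2 / 3 \<le> measure_pmf.prob (reduced_word n) {w. length w = n \<and> cyclically_reduced w}"
proof -
  interpret letter_chain reduced_kernel "1 / 3" "1 / 4" by (rule letter_chain_reduced_kernel)
  let ?P = "measure_pmf.prob (reduced_word n)" and ?S = "{w. length w = n \<and> cyclically_reduced w}"
  have len: "length w = n" "freely_reduced w" if "w \<in> set_pmf (reduced_word n)" for w
    using that length_chain chain_reduced by (auto simp: reduced_word_eq_chain)
  have "?P (- ?S) \<le> 1 / 3"
  proof (cases "n = 1")
    case True
    have "w \<notin> - ?S" if "w \<in> set_pmf (reduced_word n)" for w
    proof -
      have "length w = 1" using len[OF that] True by simp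
      then obtain s where "w = [s]" by (auto simp: length_Suc_conv)
      moreover have "s \<noteq> inv_letter s" by (cases s) auto
      ultimately show ?thesis using len[OF that] by (simp add: cyclically_reduced_def)
    qed
    then have "?P (- ?S) = 0" by (subst measure_pmf_zero_iff) blast
    then show ?thesis by simp
  next
    case False
    then have "2 * 1 \<le> n" using assms by simp
    have "?P (- ?S) \<le> ?P {w. cancelling 1 w}"
    proof (intro measure_pmf.finite_measure_mono_AE AE_pmfI impI)
      fix w assume w: "w \<in> set_pmf (reduced_word n)" "w \<in> - ?S"
      then have "w \<noteq> []" "last w = inv_letter (hd w)" using len[OF w(1)] assms by (auto simp: cyclically_reduced_def)
      then have "drop (length w - 1) w = [inv_letter (hd w)]" "take 1 w = [hd w]"
        using append_butlast_last_id[of w] by (metis append_eq_conv_conj length_butlast, cases w) auto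
      then show "w \<in> {w. cancelling 1 w}" by (simp add: cancelling_def inv_word_def)
    qed auto
    also have "\<dots> \<le> (1 / 3) ^ 1" unfolding reduced_word_eq_chain by (rule prob_cancelling[OF \<open>2 * 1 \<le> n\<close>])
    finally show ?thesis by simp
  qed
  then show ?thesis
    using measure_pmf.prob_compl[of ?S "reduced_word n"] by (simp add: Compl_eq_Diff_UNIV)
qed

text \<open>All reduced words of length n have equal probability, so the uniform law on cyclically
  reduced words is a conditional law. The conditioning event has probability at least 2/3, hence the
  factor 3/2.\<close>

lemma prob_cyc_reduced_word_le:
  assumes "n \<ge> 1"
  shows "measure_pmf.prob (cyc_reduced_word n) B \<le> 3 / 2 * measure_pmf.prob (reduced_word n) B"
proof -
  let ?P = "measure_pmf.prob (reduced_word n)" and ?S = "{w. length w = n \<and> cyclically_reduced w}"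
  define q :: real where "q = 1 / 4 * (1 / 3) ^ (n - 1)"
  have P: "?P T = real (card T) * q" if "T \<subseteq> ?S" for T
  proof -
    have "finite T" using finite_subset[OF that] finite_words by blast
    then have "?P T = (\<Sum>w\<in>T. pmf (reduced_word n) w)" by (rule measure_measure_pmf_finite)
    also have "\<dots> = (\<Sum>w\<in>T. q)"
      using that assms by (intro sum.cong refl) (auto simp: q_def pmf_reduced_word cyclically_reduced_def)
    finally show ?thesis by simp
  qed
  have S: "2 / 3 \<le> ?P ?S" by (rule prob_cyclically_reduced[OF assms])
  then have "card ?S \<noteq> 0" using P[of ?S] by (intro notI) simp
  then have ne: "?S \<noteq> {}" by (metis card.empty)
  have "measure_pmf.prob (cyc_reduced_word n) B = real (card (?S \<inter> B)) / real (card ?S)"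
    unfolding cyc_reduced_word_def by (intro measure_pmf_of_set ne finite_words)
  also have "\<dots> = ?P (?S \<inter> B) / ?P ?S"
  proof -
    have "q \<noteq> 0" by (simp add: q_def)
    then show ?thesis by (simp add: P)
  qed
  also have "\<dots> \<le> ?P (?S \<inter> B) / (2 / 3)"
    using S by (intro divide_left_mono) (auto intro!: mult_pos_pos)
  also have "?P (?S \<inter> B) \<le> ?P B"
    by (intro measure_pmf.finite_measure_mono) auto
  finally show ?thesis by simp
qed

lemma exp_likely_good_words_model:
  assumes "W \<in> word_models \<union> {cyc_reduced_word}"
  shows "\<exists>\<epsilon>>0. exp_likely W (good_words \<epsilon>)"
proof -
  have red: "\<exists>\<epsilon>>0. exp_likely reduced_word (good_words \<epsilon>)"
    using letter_chain.exp_likely_good_words[OF letter_chain_reduced_kernel, of None]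
    by (simp add: reduced_word_eq_chain[abs_def])
  consider p where "0 < p" "p < 1" "W = positive_word p" | "W = reduced_word" | "W = cyc_reduced_word"
    using assms by (auto simp: word_models_def)
  then show ?thesis
  proof cases
    case 1
    have "W = (\<lambda>n. chain (positive_kernel p) n None)"
      using 1(3) by (auto simp: positive_word_eq_chain)
    then show ?thesis
      using letter_chain.exp_likely_good_words[OF letter_chain_positive_kernel[OF 1(1,2)], of None] by simp
  next
    case 2
    then show ?thesis using red by simp
  next
    case 3
    obtain \<epsilon> C \<mu> where \<epsilon>: "\<epsilon> > 0" and C: "C > 0" "\<mu> > 0"
      and prob: "\<And>n. n \<ge> 1 \<Longrightarrow> 1 - C * exp (- \<mu> * real n) \<le> measure_pmf.prob (reduced_word n) (good_words \<epsilon> n)"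
      using red unfolding exp_likely_def by blast
    have compl: "measure_pmf.prob M (good_words \<epsilon> n) = 1 - measure_pmf.prob M (- good_words \<epsilon> n)" for n M
      using measure_pmf.prob_compl[of "good_words \<epsilon> n" M] by (simp add: Compl_eq_Diff_UNIV)
    have "1 - (3 / 2 * C) * exp (- \<mu> * real n) \<le> measure_pmf.prob (W n) (good_words \<epsilon> n)" if "n \<ge> 1" for n
      using prob_cyc_reduced_word_le[OF that, of "- good_words \<epsilon> n"] prob[OF that]
      unfolding 3 compl by (simp add: field_simps)
    then show ?thesis using \<epsilon> C unfolding exp_likely_def
      by (intro exI[of _ \<epsilon>] conjI exI[of _ "3 / 2 * C"] exI[of _ \<mu>]) auto
  qed
qed

section \<open>Coefficients of typical trace polynomials\<close>

lemma count_list_map_ge: "count_list xs x \<le> count_list (map f xs) (f x)"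
  by (induction xs) auto

text \<open>Here a and b count the exponents 3 among the a- and b-syllables, m is the number of
  syllable pairs, and P, Q are the coefficients of the two products. The top degrees are e + 2a and
  f + 2b, so the upper bounds concern depth 3 below the top, where a binomial coefficient with lower
  index 3 is at most n^3, and the top itself.\<close>

lemma trace_poly_good_word:
  assumes w: "w \<in> good_words \<epsilon> n" and \<epsilon>: "0 < \<epsilon>"
  shows "\<exists>m e f a b P Q.
    (\<forall>i j. \<bar>Poly_Mapping.lookup (trace_poly w) (i, j, m)\<bar> = int (P i * Q j)) \<and>
    \<epsilon> * real n \<le> real a \<and> \<epsilon> * real n \<le> real b \<and>
    (\<forall>i. (a choose i) \<le> P (e + 2 * i)) \<and> (\<forall>j. (b choose j) \<le> Q (f + 2 * j)) \<and>
    (3 \<le> a \<longrightarrow> P (e + 2 * (a - 3)) \<le> n ^ 3) \<and> Q (f + 2 * b) \<le> 1"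
proof -
  obtain j where wd: "length w = n" "freely_reduced w" "18 * j \<le> n" "\<not> cancelling (9 * j) w"
    and gb: "\<epsilon> * real n + 10 * real j < real (good_blocks w)"
    using w unfolding good_words_def by blast
  have "0 \<le> \<epsilon> * real n" using \<epsilon> by simp
  then have gb': "10 * j < good_blocks w" using gb by linarith
  obtain ps where ps: "ps \<noteq> []" "set ps \<subseteq> syllable_pairs"
    and tr: "\<And>A B. det A = 1 \<Longrightarrow> det B = 1 \<Longrightarrow>
       trace (word_image A B w) = trace (word_image A B (concat (map syllable_word ps)))"
    and len: "length (concat (map syllable_word ps)) \<le> n"
    and cnt: "good_blocks w \<le> 10 * j + count_list ps cube_pair"
    using cyclic_syllables[of w j] wd gb' unfolding cancelling_def by blast
  define ks ls where "ks = map (snd \<circ> fst) ps" and "ls = map (snd \<circ> snd) ps"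
  have pos: "\<forall>k\<in>set ks. k \<ge> 1" "\<forall>k\<in>set ls. k \<ge> 1"
    using ps(2) by (auto simp: ks_def ls_def syllable_pairs_def)
  have sum: "sum_list ks \<le> n"
  proof -
    have "sum_list ks \<le> length (concat (map syllable_word ps))"
      unfolding ks_def length_concat map_map by (intro sum_list_mono) (auto simp: syllable_word_def)
    then show ?thesis using len by simp
  qed
  define a b where "a = count_list ks 3" and "b = count_list ls 3"
  have "count_list ps cube_pair \<le> a" "count_list ps cube_pair \<le> b"
    using count_list_map_ge[of ps cube_pair "snd \<circ> fst"] count_list_map_ge[of ps cube_pair "snd \<circ> snd"]
    by (simp_all add: a_def b_def ks_def ls_def cube_pair_def)
  then have ab: "\<epsilon> * real n \<le> real a" "\<epsilon> * real n \<le> real b" using gb cnt by linarith+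
  define e f where "e = (\<Sum>k\<leftarrow>ks. k - 1) - 2 * a" and "f = (\<Sum>k\<leftarrow>ls. k - 1) - 2 * b"
  have ea: "e + 2 * a = (\<Sum>k\<leftarrow>ks. k - 1)" and fb: "f + 2 * b = (\<Sum>k\<leftarrow>ls. k - 1)"
    using abs_cheb_prod_ge[OF pos(1), THEN conjunct2] abs_cheb_prod_ge[OF pos(2), THEN conjunct2]
    unfolding e_def f_def a_def b_def by linarith+
  let ?P = "coeff (\<Prod>k\<leftarrow>ks. abs_cheb k :: nat poly)" and ?Q = "coeff (\<Prod>k\<leftarrow>ls. abs_cheb k :: nat poly)"
  have "\<bar>Poly_Mapping.lookup (trace_poly w) (i, j, length ps)\<bar> = int (?P i * ?Q j)" for i j
    unfolding ks_def ls_def using ps tr by (rule lookup_trace_poly)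
  moreover have "(a choose i) \<le> ?P (e + 2 * i)" for i
    unfolding a_def e_def by (rule coeff_abs_cheb_prod_ge[OF pos(1)])
  moreover have "(b choose i) \<le> ?Q (f + 2 * i)" for i
    unfolding b_def f_def by (rule coeff_abs_cheb_prod_ge[OF pos(2)])
  moreover have "?P (e + 2 * (a - 3)) \<le> n ^ 3" if "3 \<le> a"
  proof -
    have "e + 2 * (a - 3) + 2 * 3 = (\<Sum>k\<leftarrow>ks. k - 1)" using ea that by linarith
    then have "?P (e + 2 * (a - 3)) \<le> sum_list ks choose 3" by (rule coeff_abs_cheb_prod_le[OF pos(1)])
    also have "\<dots> \<le> sum_list ks ^ 3" 
      by (cases "3 \<le> sum_list ks") (simp_all add: binomial_le_pow binomial_eq_0)
    also have "\<dots> \<le> n ^ 3" using sum by (rule power_mono) simp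
    finally show ?thesis .
  qed
  moreover have "?Q (f + 2 * b) \<le> 1"
    using coeff_abs_cheb_prod_le[OF pos(2), of "f + 2 * b" 0] fb by (simp only: mult_0_right add_0_right binomial_n_0)
  ultimately show ?thesis using ab by blast
qed

lemma card_keys_good_word:
  assumes w: "w \<in> good_words \<epsilon> n" and \<epsilon>: "0 < \<epsilon>"
  shows "\<epsilon> ^ 2 * real n ^ 2 \<le> real (card (Poly_Mapping.keys (trace_poly w)))"
proof -
  obtain m e f a b P Q where look: "\<forall>i j. \<bar>Poly_Mapping.lookup (trace_poly w) (i, j, m)\<bar> = int (P i * Q j)"
    and ab: "\<epsilon> * real n \<le> real a" "\<epsilon> * real n \<le> real b"
    and PQ: "\<forall>i. (a choose i) \<le> P (e + 2 * i)" "\<forall>j. (b choose j) \<le> Q (f + 2 * j)"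
    and P3: "3 \<le> a \<longrightarrow> P (e + 2 * (a - 3)) \<le> n ^ 3" and Qb: "Q (f + 2 * b) \<le> 1"
    using trace_poly_good_word[OF w \<epsilon>] by (elim exE conjE)
  note look = look[rule_format] and PQ = PQ[rule_format] and P3 = P3[rule_format]
  let ?g = "\<lambda>(i, j). (e + 2 * i, f + 2 * j, m)"
  have "inj_on ?g ({..a} \<times> {..b})" by (auto simp: inj_on_def)
  moreover have "?g ` ({..a} \<times> {..b}) \<subseteq> Poly_Mapping.keys (trace_poly w)"
  proof safe
    fix i j assume "i \<le> a" "j \<le> b"
    then have "0 < (a choose i)" "0 < (b choose j)" by simp_all
    then have "0 < P (e + 2 * i)" "0 < Q (f + 2 * j)"
      using PQ(1)[of i] PQ(2)[of j] by linarith+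
    then have "0 < int (P (e + 2 * i) * Q (f + 2 * j))" by simp
    then have "0 < \<bar>Poly_Mapping.lookup (trace_poly w) (e + 2 * i, f + 2 * j, m)\<bar>"
      unfolding look .
    then show "(e + 2 * i, f + 2 * j, m) \<in> Poly_Mapping.keys (trace_poly w)"
      by (auto simp: in_keys_iff)
  qed
  ultimately have "card ({..a} \<times> {..b}) \<le> card (Poly_Mapping.keys (trace_poly w))"
    by (rule card_inj_on_le) simp
  then have "(a + 1) * (b + 1) \<le> card (Poly_Mapping.keys (trace_poly w))" by simp
  moreover have "(\<epsilon> * real n) * (\<epsilon> * real n) \<le> real (a + 1) * real (b + 1)"
    using ab \<epsilon> by (intro mult_mono) auto
  moreover have "\<epsilon> ^ 2 * real n ^ 2 = (\<epsilon> * real n) * (\<epsilon> * real n)"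
    by (simp add: power2_eq_square)
  ultimately show ?thesis
    by (metis of_nat_le_iff of_nat_mult order.trans)
qed

text \<open>The coefficient at depth 3 in x and at the top in y lies between
  \<open>a choose 3\<close>, which is at least (a/3)^3, and n^3. The condition on n ensures a >=
  3.\<close>

lemma cubic_coefficient_good_word:
  assumes w: "w \<in> good_words \<epsilon> n" and \<epsilon>: "0 < \<epsilon>" and n: "3 / \<epsilon> \<le> real n"
  shows "\<exists>i j k. (\<epsilon> / 3) ^ 3 * real n ^ 3 \<le> \<bar>real_of_int (Poly_Mapping.lookup (trace_poly w) (i, j, k))\<bar> \<and>
     \<bar>real_of_int (Poly_Mapping.lookup (trace_poly w) (i, j, k))\<bar> \<le> 1 * real n ^ 3"
proof -
  obtain m e f a b P Q where look: "\<forall>i j. \<bar>Poly_Mapping.lookup (trace_poly w) (i, j, m)\<bar> = int (P i * Q j)"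
    and ab: "\<epsilon> * real n \<le> real a" "\<epsilon> * real n \<le> real b"
    and PQ: "\<forall>i. (a choose i) \<le> P (e + 2 * i)" "\<forall>j. (b choose j) \<le> Q (f + 2 * j)"
    and P3: "3 \<le> a \<longrightarrow> P (e + 2 * (a - 3)) \<le> n ^ 3" and Qb: "Q (f + 2 * b) \<le> 1"
    using trace_poly_good_word[OF w \<epsilon>] by (elim exE conjE)
  note look = look[rule_format] and PQ = PQ[rule_format] and P3 = P3[rule_format]
  have "3 \<le> \<epsilon> * real n" using n \<epsilon> by (simp add: field_simps)
  then have a3: "3 \<le> a" using ab(1) by linarith
  have "Q (f + 2 * b) = 1" using PQ(2)[of b] Qb by simp
  then have v: "\<bar>real_of_int (Poly_Mapping.lookup (trace_poly w) (e + 2 * (a - 3), f + 2 * b, m))\<bar>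
      = real (P (e + 2 * (a - 3)))"
    unfolding of_int_abs[symmetric] look by simp
  have "(\<epsilon> / 3) ^ 3 * real n ^ 3 = (\<epsilon> * real n / 3) ^ 3" by (simp add: power_mult_distrib power_divide)
  also have "\<dots> \<le> (real a / real 3) ^ 3" using ab(1) \<epsilon> by (intro power_mono) auto
  also have "\<dots> \<le> real (a choose 3)" using a3 by (rule binomial_ge_n_over_k_pow_k)
  also have "\<dots> = real (a choose (a - 3))" using a3 by (simp only: binomial_symmetric[of 3 a])
  also have "\<dots> \<le> real (P (e + 2 * (a - 3)))" using PQ(1)[of "a - 3"] by (simp only: of_nat_le_iff)
  finally have lo: "(\<epsilon> / 3) ^ 3 * real n ^ 3 \<le> real (P (e + 2 * (a - 3)))" .
  have "real (P (e + 2 * (a - 3))) \<le> real (n ^ 3)" using P3[OF a3] by (simp only: of_nat_le_iff)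
  then show ?thesis
    using v lo by - (rule exI[of _ "e + 2 * (a - 3)"], rule exI[of _ "f + 2 * b"], rule exI[of _ m], simp)
qed

lemma two_power_le_binomial:
  assumes "2 * i \<le> a"
  shows "2 ^ i \<le> a choose i"
proof (cases "i = 0")
  case False
  have "(2::real) ^ i \<le> (real a / real i) ^ i"
    using assms False by (intro power_mono) (auto simp: field_simps)
  also have "\<dots> \<le> real (a choose i)" using assms by (intro binomial_ge_n_over_k_pow_k) simp
  finally have "real (2 ^ i) \<le> real (a choose i)" by simp
  then show ?thesis by (simp only: of_nat_le_iff)
qed simp

text \<open>For i up to a/2 the binomial coefficient is at least 2^i, so the coefficient needs more
  than i bits. Summing over these i and over all j up to b gives a quadratic factor times a linear
  one.\<close>

lemma bit_norm_good_word:
  assumes w: "w \<in> good_words \<epsilon> n" and \<epsilon>: "0 < \<epsilon>"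
  shows "\<epsilon> ^ 3 / 8 * real n ^ 3 \<le> real (bit_norm (trace_poly w))"
proof -
  obtain m e f a b P Q where look: "\<forall>i j. \<bar>Poly_Mapping.lookup (trace_poly w) (i, j, m)\<bar> = int (P i * Q j)"
    and ab: "\<epsilon> * real n \<le> real a" "\<epsilon> * real n \<le> real b"
    and PQ: "\<forall>i. (a choose i) \<le> P (e + 2 * i)" "\<forall>j. (b choose j) \<le> Q (f + 2 * j)"
    and P3: "3 \<le> a \<longrightarrow> P (e + 2 * (a - 3)) \<le> n ^ 3" and Qb: "Q (f + 2 * b) \<le> 1"
    using trace_poly_good_word[OF w \<epsilon>] by (elim exE conjE)
  note look = look[rule_format] and PQ = PQ[rule_format] and P3 = P3[rule_format]
  define h where "h = a div 2"
  let ?g = "\<lambda>(i, j). (e + 2 * i, f + 2 * j, m)"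
  let ?L = "Poly_Mapping.lookup (trace_poly w)"
  have bits: "Suc i \<le> bit_length (?L (?g (i, j)))" if "i \<le> h" "j \<le> b" for i j
  proof -
    have "2 ^ i * 1 \<le> P (e + 2 * i) * Q (f + 2 * j)"
    proof (rule mult_mono)
      have "2 ^ i \<le> a choose i" using that by (intro two_power_le_binomial) (simp add: h_def)
      then show "2 ^ i \<le> P (e + 2 * i)" using PQ(1) order.trans by blast
      have "1 \<le> b choose j" using that by (simp add: Suc_leI)
      then show "1 \<le> Q (f + 2 * j)" using PQ(2) order.trans by blast
    qed simp_all
    then have "int (2 ^ i) \<le> \<bar>?L (?g (i, j))\<bar>" unfolding prod.case look by (simp only: of_nat_le_iff mult_1_right)
    then show ?thesis using less_bit_length[of i "?L (?g (i, j))"] by simp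
  qed
  have inj: "inj_on ?g ({..h} \<times> {..b})" by (auto simp: inj_on_def)
  have keys: "?g ` ({..h} \<times> {..b}) \<subseteq> Poly_Mapping.keys (trace_poly w)"
  proof (rule image_subsetI)
    fix p assume "p \<in> {..h} \<times> {..b}"
    then obtain i j where p: "p = (i, j)" "i \<le> h" "j \<le> b" by auto
    have "bit_length 0 = 0" by (simp add: bit_length_def binary_expansion.simps)
    then have "?L (?g p) \<noteq> 0" using bits[OF p(2,3)] p(1) by (metis Suc_n_not_le_n le_zero_eq not_less_eq_eq zero_le)
    then show "?g p \<in> Poly_Mapping.keys (trace_poly w)" by (simp only: in_keys_iff not_False_eq_True)
  qed
  have "(\<Sum>i\<le>h. Suc i) * (b + 1) = (\<Sum>(i, j)\<in>{..h} \<times> {..b}. Suc i)"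
    by (simp add: sum.cartesian_product[symmetric] sum_distrib_right mult.commute sum_distrib_left)
  also have "\<dots> \<le> (\<Sum>p\<in>{..h} \<times> {..b}. bit_length (?L (?g p)))"
    using bits by (intro sum_mono) auto
  also have "\<dots> = (\<Sum>q\<in>?g ` ({..h} \<times> {..b}). bit_length (?L q))"
    by (simp only: sum.reindex[OF inj] comp_def)
  also have "\<dots> \<le> bit_norm (trace_poly w)"
    unfolding bit_norm_def by (intro sum_mono2 keys) auto
  finally have le: "(\<Sum>i\<le>h. Suc i) * (b + 1) \<le> bit_norm (trace_poly w)" .
  have "2 * (\<Sum>i\<le>h. Suc i) = (h + 1) * (h + 2)" by (induction h) auto
  then have sum: "(h + 1) * (h + 1) \<le> 2 * (\<Sum>i\<le>h. Suc i)" by simp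
  have h: "\<epsilon> * real n / 2 \<le> real (h + 1)" using ab(1) by (simp add: h_def)
  \<comment> \<open>The constant 1/8 combines two factors 1/2 from h + 1 >= \<epsilon> n / 2 with
    one from the sum over i being at least half of (h + 1)^2.\<close>
  have "(\<epsilon> * real n / 2) * (\<epsilon> * real n / 2) * (\<epsilon> * real n) \<le> real (h + 1) * real (h + 1) * real (b + 1)"
    using h ab \<epsilon> by (intro mult_mono) auto
  also have "\<dots> = real ((h + 1) * (h + 1) * (b + 1))" by (simp only: of_nat_mult)
  also have "\<dots> \<le> real (2 * (\<Sum>i\<le>h. Suc i) * (b + 1))"
    using sum by (intro of_nat_mono mult_right_mono) auto
  also have "\<dots> \<le> real (2 * bit_norm (trace_poly w))"
    using le by (intro of_nat_mono) simp
  finally show ?thesis by (simp add: power3_eq_cube mult_ac)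
qed

text \<open>Enlarging C to at least \<open>exp (\<mu> * n0)\<close> makes the claimed bound at most
  0 for all n below \<open>n0\<close>.\<close>

lemma exp_likely_mono:
  assumes "exp_likely W S"
    and "\<And>n w. n0 \<le> real n \<Longrightarrow> w \<in> S n \<Longrightarrow> w \<in> S' n"
  shows "exp_likely W S'"
proof -
  obtain C \<mu> where C: "C > 0" "\<mu> > 0"
    and prob: "\<And>n. n \<ge> 1 \<Longrightarrow> 1 - C * exp (- \<mu> * real n) \<le> measure_pmf.prob (W n) (S n)"
    using assms(1) unfolding exp_likely_def by blast
  have "1 - max C (exp (\<mu> * n0)) * exp (- \<mu> * real n) \<le> measure_pmf.prob (W n) (S' n)" if "n \<ge> 1" for n
  proof (cases "n0 \<le> real n")
    case True
    have "1 - max C (exp (\<mu> * n0)) * exp (- \<mu> * real n) \<le> 1 - C * exp (- \<mu> * real n)" by simp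
    also have "\<dots> \<le> measure_pmf.prob (W n) (S n)" by (rule prob[OF that])
    also have "\<dots> \<le> measure_pmf.prob (W n) (S' n)"
      using assms(2)[OF True] by (intro measure_pmf.finite_measure_mono) auto
    finally show ?thesis .
  next
    case False
    have "1 \<le> exp (\<mu> * n0) * exp (- \<mu> * real n)"
      using False C by (simp flip: exp_add)
    also have "\<dots> \<le> max C (exp (\<mu> * n0)) * exp (- \<mu> * real n)" by (intro mult_right_mono) auto
    finally show ?thesis using measure_nonneg[of "W n" "S' n"] by linarith
  qed
  then show ?thesis unfolding exp_likely_def using C
    by (intro exI[of _ "max C (exp (\<mu> * n0))"] exI[of _ \<mu>]) auto
qed

text \<open>The good words and their constants are fixed before the machine, so the bound is uniform
  in M.\<close>

lemma running_time_lower_bound: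
  assumes W: "W \<in> word_models \<union> {cyc_reduced_word}" and R: "sparse_binary_convention R"
  shows "\<exists>c>0. \<exists>C>0. \<exists>\<mu>>0. \<forall>M. \<forall>n\<ge>1.
    computes_trace_poly_on M R (set_pmf (W n)) \<longrightarrow>
    measure_pmf.prob (W n) {w. real (running_time M w) \<ge> c * real n ^ 3} \<ge> 1 - C * exp (- \<mu> * real n)"
proof -
  obtain \<epsilon> where \<epsilon>: "0 < \<epsilon>" "exp_likely W (good_words \<epsilon>)"
    using exp_likely_good_words_model[OF W] by blast
  \<comment> \<open>Half of the constant in \<open>bit_norm_good_word\<close>; the other half
    absorbs the input length n, which is at most c n^3 once n is at least 1 and 1/c.\<close>
  define c where "c = \<epsilon> ^ 3 / 16"
  have c: "0 < c" using \<epsilon> by (simp add: c_def)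
  define n0 where "n0 = max 1 (1 / c)"
  have "exp_likely W (\<lambda>n. {w \<in> good_words \<epsilon> n. n0 \<le> real n})"
    by (rule exp_likely_mono[OF \<epsilon>(2), of n0]) auto
  then obtain C \<mu> where C: "C > 0" "\<mu> > 0"
    and prob: "\<And>n. n \<ge> 1 \<Longrightarrow> 1 - C * exp (- \<mu> * real n) \<le> measure_pmf.prob (W n) {w \<in> good_words \<epsilon> n. n0 \<le> real n}"
    unfolding exp_likely_def by blast
  have "1 - C * exp (- \<mu> * real n) \<le> measure_pmf.prob (W n) {w. real (running_time M w) \<ge> c * real n ^ 3}"
    if n: "n \<ge> 1" and M: "computes_trace_poly_on M R (set_pmf (W n))" for M n
  proof -
    have "measure_pmf.prob (W n) {w \<in> good_words \<epsilon> n. n0 \<le> real n}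
      \<le> measure_pmf.prob (W n) {w. real (running_time M w) \<ge> c * real n ^ 3}"
    proof (intro measure_pmf.finite_measure_mono_AE AE_pmfI impI)
      fix w assume w: "w \<in> set_pmf (W n)" "w \<in> {w \<in> good_words \<epsilon> n. n0 \<le> real n}"
      have "2 * c * real n ^ 3 \<le> real (bit_norm (trace_poly w))"
        using bit_norm_good_word[of w \<epsilon> n] w(2) \<epsilon> by (simp add: c_def)
      also have "\<dots> \<le> real n + real (running_time M w)"
        using bit_norm_le_running_time[OF R M w(1)] w(2) by (simp add: good_words_def)
      finally have "2 * c * real n ^ 3 \<le> real n + real (running_time M w)" .
      moreover have "real n \<le> c * real n ^ 3"
      proof -
        have "1 \<le> real n" "1 / c \<le> real n" using w(2) by (auto simp: n0_def)
        then have "1 \<le> c * real n" using c by (simp add: field_simps)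
        then have "1 * (real n * 1) \<le> (c * real n) * (real n * real n)"
          using \<open>1 \<le> real n\<close> by (intro mult_mono) auto
        then show ?thesis by (simp add: power3_eq_cube mult_ac)
      qed
      ultimately show "w \<in> {w. real (running_time M w) \<ge> c * real n ^ 3}" by simp
    qed auto
    then show ?thesis using prob[OF n] by linarith
  qed
  then show ?thesis using c C by blast
qed

lemma set_pmf_cyc_reduced_word:
  assumes "n \<ge> 1"
  shows "set_pmf (cyc_reduced_word n) = {w. length w = n \<and> cyclically_reduced w}"
proof -
  have "measure_pmf.prob (reduced_word n) {w. length w = n \<and> cyclically_reduced w} \<noteq> 0"
    using prob_cyclically_reduced[OF assms] by linarith
  then have "{w. length w = n \<and> cyclically_reduced w} \<noteq> {}" by (metis measure_empty)
  then show ?thesis unfolding cyc_reduced_word_def by (intro set_pmf_of_set finite_words)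
qed

theorem theorem1p8:
  shows "(\<forall>W\<in>word_models. \<exists>c>0. \<exists>C>0. \<exists>\<mu>>0. \<forall>n\<ge>1.
            measure_pmf.prob (W n)
              {w. real (card (Poly_Mapping.keys (trace_poly w))) \<ge> c * real n ^ 2}
            \<ge> 1 - C * exp (- \<mu> * real n))
       \<and> (\<forall>W\<in>word_models. \<exists>c\<^sub>1>0. \<exists>c\<^sub>2>0. \<exists>C>0. \<exists>\<mu>>0. \<forall>n\<ge>1.
            measure_pmf.prob (W n)
              {w. \<exists>i j k.
                 c\<^sub>1 * real n ^ 3 \<le> \<bar>real_of_int (Poly_Mapping.lookup (trace_poly w) (i, j, k))\<bar> \<and>
                 \<bar>real_of_int (Poly_Mapping.lookup (trace_poly w) (i, j, k))\<bar> \<le> c\<^sub>2 * real n ^ 3}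
            \<ge> 1 - C * exp (- \<mu> * real n))
       \<and> (\<forall>W\<in>word_models. \<exists>c\<^sub>3>0. \<exists>C\<^sub>3>0. \<exists>\<mu>\<^sub>3>0. \<forall>n\<ge>1.
            measure_pmf.prob (W n) {w. real (bit_norm (trace_poly w)) \<ge> c\<^sub>3 * real n ^ 3}
            \<ge> 1 - C\<^sub>3 * exp (- \<mu>\<^sub>3 * real n))
       \<and> (\<forall>W\<in>word_models. \<forall>R. sparse_binary_convention R \<longrightarrow>
            (\<exists>c\<^sub>4>0. \<exists>C\<^sub>4>0. \<exists>\<mu>\<^sub>4>0. \<forall>M. \<forall>n\<ge>1.
               computes_trace_poly_on M R (set_pmf (W n)) \<longrightarrow>
               measure_pmf.prob (W n) {w. real (running_time M w) \<ge> c\<^sub>4 * real n ^ 3}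
               \<ge> 1 - C\<^sub>4 * exp (- \<mu>\<^sub>4 * real n)))
       \<and> (\<forall>R. sparse_binary_convention R \<longrightarrow>
            (\<exists>c\<^sub>5>0. \<exists>C\<^sub>5>0. \<exists>\<mu>\<^sub>5>0. \<forall>M. \<forall>n\<ge>1.
               computes_trace_poly_on M R {w. length w = n \<and> cyclically_reduced w} \<longrightarrow>
               measure_pmf.prob (cyc_reduced_word n) {w. real (running_time M w) \<ge> c\<^sub>5 * real n ^ 3}
               \<ge> 1 - C\<^sub>5 * exp (- \<mu>\<^sub>5 * real n)))
       \<and> (\<forall>W \<in> word_models \<union> {cyc_reduced_word}. \<forall>R M. sparse_binary_convention R \<longrightarrow>
            (\<forall>n\<ge>1. computes_trace_poly_on M R (set_pmf (W n))) \<longrightarrow>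
            (\<exists>c>0. \<exists>C>0. \<exists>\<mu>>0. \<forall>n\<ge>1.
               measure_pmf.prob (W n) {w. real (running_time M w) \<ge> c * real n ^ 3}
               \<ge> 1 - C * exp (- \<mu> * real n)))"
proof (intro conjI ballI allI impI)
  fix W assume W: "W \<in> word_models"
  then obtain \<epsilon> where \<epsilon>: "0 < \<epsilon>" "exp_likely W (good_words \<epsilon>)"
    using exp_likely_good_words_model by blast
  show "\<exists>c>0. \<exists>C>0. \<exists>\<mu>>0. \<forall>n\<ge>1.
            measure_pmf.prob (W n)
              {w. real (card (Poly_Mapping.keys (trace_poly w))) \<ge> c * real n ^ 2}
            \<ge> 1 - C * exp (- \<mu> * real n)"
    using exp_likely_mono[OF \<epsilon>(2), of 0 "\<lambda>n. {w. real (card (Poly_Mapping.keys (trace_poly w))) \<ge> \<epsilon> ^ 2 * real n ^ 2}"]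
      card_keys_good_word \<epsilon>(1) unfolding exp_likely_def
    by (intro exI[of _ "\<epsilon> ^ 2"]) auto
  show "\<exists>c\<^sub>1>0. \<exists>c\<^sub>2>0. \<exists>C>0. \<exists>\<mu>>0. \<forall>n\<ge>1.
            measure_pmf.prob (W n)
              {w. \<exists>i j k.
                 c\<^sub>1 * real n ^ 3 \<le> \<bar>real_of_int (Poly_Mapping.lookup (trace_poly w) (i, j, k))\<bar> \<and>
                 \<bar>real_of_int (Poly_Mapping.lookup (trace_poly w) (i, j, k))\<bar> \<le> c\<^sub>2 * real n ^ 3}
            \<ge> 1 - C * exp (- \<mu> * real n)"
    (is "\<exists>c\<^sub>1>0. \<exists>c\<^sub>2>0. ?P c\<^sub>1 c\<^sub>2")
  proof -
    have "?P ((\<epsilon> / 3) ^ 3) 1"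
      unfolding exp_likely_def[symmetric]
      by (rule exp_likely_mono[OF \<epsilon>(2), of "3 / \<epsilon>"])
         (intro CollectI cubic_coefficient_good_word \<epsilon>(1))
    moreover have "0 < (\<epsilon> / 3) ^ 3" using \<epsilon>(1) by simp
    ultimately show ?thesis using zero_less_one by blast
  qed
  show "\<exists>c\<^sub>3>0. \<exists>C\<^sub>3>0. \<exists>\<mu>\<^sub>3>0. \<forall>n\<ge>1.
            measure_pmf.prob (W n) {w. real (bit_norm (trace_poly w)) \<ge> c\<^sub>3 * real n ^ 3}
            \<ge> 1 - C\<^sub>3 * exp (- \<mu>\<^sub>3 * real n)"
    using exp_likely_mono[OF \<epsilon>(2), of 0 "\<lambda>n. {w. real (bit_norm (trace_poly w)) \<ge> \<epsilon> ^ 3 / 8 * real n ^ 3}"]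
      bit_norm_good_word \<epsilon>(1) unfolding exp_likely_def
    by (intro exI[of _ "\<epsilon> ^ 3 / 8"]) auto
next
  fix W R assume "W \<in> word_models" "sparse_binary_convention R"
  then show "\<exists>c\<^sub>4>0. \<exists>C\<^sub>4>0. \<exists>\<mu>\<^sub>4>0. \<forall>M. \<forall>n\<ge>1.
               computes_trace_poly_on M R (set_pmf (W n)) \<longrightarrow>
               measure_pmf.prob (W n) {w. real (running_time M w) \<ge> c\<^sub>4 * real n ^ 3}
               \<ge> 1 - C\<^sub>4 * exp (- \<mu>\<^sub>4 * real n)"
    by (intro running_time_lower_bound) auto
next
  fix R assume "sparse_binary_convention R"
  then obtain c C \<mu> where pos: "c > 0" "C > 0" "\<mu> > 0"
    and bound: "\<And>M n. n \<ge> 1 \<Longrightarrow> computes_trace_poly_on M R (set_pmf (cyc_reduced_word n)) \<Longrightarrow>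
      measure_pmf.prob (cyc_reduced_word n) {w. real (running_time M w) \<ge> c * real n ^ 3} \<ge> 1 - C * exp (- \<mu> * real n)"
    using running_time_lower_bound[of cyc_reduced_word R] by blast
  have "measure_pmf.prob (cyc_reduced_word n) {w. real (running_time M w) \<ge> c * real n ^ 3} \<ge> 1 - C * exp (- \<mu> * real n)"
    if "n \<ge> 1" "computes_trace_poly_on M R {w. length w = n \<and> cyclically_reduced w}" for M n
    using that(2) unfolding set_pmf_cyc_reduced_word[OF that(1), symmetric] by (rule bound[OF that(1)])
  with pos show "\<exists>c\<^sub>5>0. \<exists>C\<^sub>5>0. \<exists>\<mu>\<^sub>5>0. \<forall>M. \<forall>n\<ge>1.
               computes_trace_poly_on M R {w. length w = n \<and> cyclically_reduced w} \<longrightarrow>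
               measure_pmf.prob (cyc_reduced_word n) {w. real (running_time M w) \<ge> c\<^sub>5 * real n ^ 3}
               \<ge> 1 - C\<^sub>5 * exp (- \<mu>\<^sub>5 * real n)"
    by blast
next
  fix W R M assume W: "W \<in> word_models \<union> {cyc_reduced_word}" and R: "sparse_binary_convention R"
    and M: "\<forall>n\<ge>1. computes_trace_poly_on M R (set_pmf (W n))"
  obtain c C \<mu> where pos: "c > 0" "C > 0" "\<mu> > 0"
    and bound: "\<forall>M. \<forall>n\<ge>1. computes_trace_poly_on M R (set_pmf (W n)) \<longrightarrow>
      measure_pmf.prob (W n) {w. real (running_time M w) \<ge> c * real n ^ 3} \<ge> 1 - C * exp (- \<mu> * real n)"
    using running_time_lower_bound[OF W R] by blast
  have "\<forall>n\<ge>1. measure_pmf.prob (W n) {w. real (running_time M w) \<ge> c * real n ^ 3} \<ge> 1 - C * exp (- \<mu> * real n)"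
    using bound[rule_format] M by simp
  with pos show "\<exists>c>0. \<exists>C>0. \<exists>\<mu>>0. \<forall>n\<ge>1.
               measure_pmf.prob (W n) {w. real (running_time M w) \<ge> c * real n ^ 3}
               \<ge> 1 - C * exp (- \<mu> * real n)"
    by blast
qed

end
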